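(* Let $J$ be a two-sided Jacobi matrix with coefficients $a_n>0$, $b_n\in\mathbb R$ ($n\in\mathbb Z$), limit-point at both $\pm\infty$. Fix $\xi\in\mathbb R$ such that the normal limit $\lim_{y\downarrow0}m_+(\xi+iy)=\eta$ exists and lies in $\mathbb C_+$. Assume that the integer sequences $k_l,n_l$ are such that $$\lim_{l\to\infty}\frac{\tau_{k_l}}{\tau_{n_l}}=\sigma\in[0,1),$$ the sequence $k_l$ is bounded below, $n_l\to\infty$ as $l\to\infty$, and the limit $\lim_{l\to\infty}v_{k_l}/\|v_{k_l}\|$ exists. Then for $z,w\in\mathbb C$, $$\lim_{l\to\infty}\frac{K_{[k_l,n_l]}\left(\xi+\frac{z}{h_\eta(\tau_{n_l}-\tau_{k_l})},\ \xi+\frac{w}{h_\eta(\tau_{n_l}-\tau_{k_l})}\right)}{(\tau_{n_l}-\tau_{k_l})\,v_{k_l}^*\mathring H_\eta v_{k_l}}=\frac{\sin(\overline w-z)}{\overline w-z} .$$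
   Context: $\mathbb C_+=\{z\in\mathbb C:\Im z>0\}$. $J$ acts formally by $(Ju)_n=a_{n-1}u_{n-1}+b_nu_n+a_nu_{n+1}$ on $\ell^2(\mathbb Z)$; limit-point at both $\pm\infty$ means, equivalently, that $J$ is self-adjoint with the compactly supported sequences as a core. $J_+$ is the restriction of $J$ to $\ell^2(\{n\ge1\})$ and $m_+(z)=\langle\delta_1,(J_+-z)^{-1}\delta_1\rangle$. Transfer matrices: for integers $k,n$, $T_{[k,n]}(z)$ is the $2\times2$ matrix such that $$T_{[k,n]}(z)\begin{pmatrix}u_{k+1}\\-a_ku_k\end{pmatrix}=\begin{pmatrix}u_{n+1}\\-a_nu_n\end{pmatrix}$$ for every solution $u$ of $a_{m-1}u_{m-1}+b_mu_m+a_mu_{m+1}=zu_m$ ($m\in\mathbb Z$). Let $j=\begin{pmatrix}0&-1\\1&0\end{pmatrix}$ and define $$\mathcal K_{[k,n]}(z,w)=\frac{T_{[k,n]}(w)^*jT_{[k,n]}(z)-j}{\overline w-z},\qquad K_{[k,n]}(z,w)=\begin{pmatrix}1\\0\end{pmatrix}^*\mathcal K_{[k,n]}(z,w)\begin{pmatrix}1\\0\end{pmatrix},$$ $$\tau_n=\operatorname{tr}\mathcal K_{[0,n]}(\xi,\xi),\qquad v_k=T_{[0,k]}(\xi)^{-1}\begin{pmatrix}1\\0\end{pmatrix}\in\mathbb R^2\setminus\{0\}.$$ Here and in the claim, quotients with denominator $\overline w-z$ are extended by continuity to $\overline w=z$. Finally, $$\mathring H_\eta=\frac1{1+|\eta|^2}\begin{pmatrix}1&-\Re\eta\\-\Re\eta&|\eta|^2\end{pmatrix},\qquad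 h_\eta=\frac{\Im\eta}{1+|\eta|^2}=\sqrt{\det\mathring H_\eta}.$$ *)

theory Defs
  imports "HOL-Analysis.Analysis"
begin

definition ell2 :: "(int \<Rightarrow> complex) set" where
  "ell2 = {u. (\<lambda>n. (cmod (u n))\<^sup>2) summable_on UNIV}"

definition ell2_norm :: "(int \<Rightarrow> complex) \<Rightarrow> real" where
  "ell2_norm u = sqrt (\<Sum>\<^sub>\<infinity>n. (cmod (u n))\<^sup>2)"

definition ell2_inner :: "(int \<Rightarrow> complex) \<Rightarrow> (int \<Rightarrow> complex) \<Rightarrow> complex" where
  "ell2_inner u v = (\<Sum>\<^sub>\<infinity>n. cnj (u n) * v n)"

definition delta :: "int \<Rightarrow> int \<Rightarrow> complex" where
  "delta m n = (if n = m then 1 else 0)"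

definition finite_support :: "(int \<Rightarrow> complex) set" where
  "finite_support = {u. finite {n. u n \<noteq> 0}}"

text \<open>Unbounded operators are represented by their graphs.  No density of the domain is required
  in the definition of the adjoint relation: if \<open>A\<close> is the graph of a function and
  \<open>A = op_adjoint A\<close>, then the domain is automatically dense.\<close>

type_synonym l2_op = "((int \<Rightarrow> complex) \<times> (int \<Rightarrow> complex)) set"

definition op_adjoint :: "l2_op \<Rightarrow> l2_op" where
  "op_adjoint A = {(v, g). v \<in> ell2 \<and> g \<in> ell2 \<and>
     (\<forall>(u, f) \<in> A. ell2_inner v f = ell2_inner g u)}"

definition self_adjoint :: "l2_op \<Rightarrow> bool" where
  "self_adjoint A \<longleftrightarrow> op_adjoint A = A"

definition is_core :: "(int \<Rightarrow> complex) set \<Rightarrow> l2_op \<Rightarrow> bool" where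
  "is_core D A \<longleftrightarrow> D \<subseteq> Domain A \<and>
     (\<forall>(u, f) \<in> A. \<forall>e>0. \<exists>(u', f') \<in> A. u' \<in> D \<and>
        ell2_norm (\<lambda>n. u n - u' n) < e \<and> ell2_norm (\<lambda>n. f n - f' n) < e)"

text \<open>\<open>(A - z)\<^sup>-\<^sup>1 f\<close>, i.e. the \<open>u\<close> in the domain with \<open>A u = f + z u\<close>.\<close>

definition resolvent :: "l2_op \<Rightarrow> complex \<Rightarrow> (int \<Rightarrow> complex) \<Rightarrow> (int \<Rightarrow> complex)" where
  "resolvent A z f = (THE u. (u, \<lambda>n. f n + z * u n) \<in> A)"

definition jacobi :: "(int \<Rightarrow> real) \<Rightarrow> (int \<Rightarrow> real) \<Rightarrow> (int \<Rightarrow> complex) \<Rightarrow> (int \<Rightarrow> complex)" where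
  "jacobi a b u = (\<lambda>n. of_real (a (n - 1)) * u (n - 1) + of_real (b n) * u n
                        + of_real (a n) * u (n + 1))"

text \<open>The operator \<open>J\<close> has the maximal domain.\<close>

definition J_op :: "(int \<Rightarrow> real) \<Rightarrow> (int \<Rightarrow> real) \<Rightarrow> l2_op" where
  "J_op a b = {(u, jacobi a b u) | u. u \<in> ell2 \<and> jacobi a b u \<in> ell2}"

definition limit_point_both :: "(int \<Rightarrow> real) \<Rightarrow> (int \<Rightarrow> real) \<Rightarrow> bool" where
  "limit_point_both a b \<longleftrightarrow> self_adjoint (J_op a b) \<and> is_core finite_support (J_op a b)"

text \<open>Elements of \<open>\<ell>\<^sup>2({n \<ge> 1})\<close> are identified with their extensions by zero to all integers;
  accordingly the value of \<open>J u\<close> is cut off to \<open>n \<ge> 1\<close>.\<close>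

definition J_plus :: "(int \<Rightarrow> real) \<Rightarrow> (int \<Rightarrow> real) \<Rightarrow> l2_op" where
  "J_plus a b = {(u, \<lambda>n. if n \<ge> 1 then f n else 0) | u f. (u, f) \<in> J_op a b \<and> (\<forall>n<1. u n = 0)}"

definition m_plus :: "(int \<Rightarrow> real) \<Rightarrow> (int \<Rightarrow> real) \<Rightarrow> complex \<Rightarrow> complex" where
  "m_plus a b z = ell2_inner (delta 1) (resolvent (J_plus a b) z (delta 1))"

definition transfer ::
  "(int \<Rightarrow> real) \<Rightarrow> (int \<Rightarrow> real) \<Rightarrow> int \<Rightarrow> int \<Rightarrow> complex \<Rightarrow> complex^2^2" where
  "transfer a b k n z = (THE M. \<forall>u. jacobi a b u = (\<lambda>m. z * u m) \<longrightarrow>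
      M *v vector [u (k + 1), - of_real (a k) * u k] = vector [u (n + 1), - of_real (a n) * u n])"

definition mat_adj :: "complex^2^2 \<Rightarrow> complex^2^2" where
  "mat_adj M = (\<chi> i l. cnj (M $ l $ i))"

definition j_mat :: "complex^2^2" where
  "j_mat = vector [vector [0, -1], vector [1, 0]]"

definition sesq_form :: "complex^2^2 \<Rightarrow> complex^2 \<Rightarrow> complex^2 \<Rightarrow> complex" where
  "sesq_form M x y = (\<Sum>i\<in>UNIV. cnj (x $ i) * (M *v y) $ i)"

text \<open>The quotient \<open>F(z, w) / (cnj w - z)\<close>, extended by (joint) continuity to \<open>cnj w = z\<close>.\<close>

definition ext_quot :: "(complex \<Rightarrow> complex \<Rightarrow> complex) \<Rightarrow> complex \<Rightarrow> complex \<Rightarrow> complex" where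
  "ext_quot F z w =
     (if cnj w \<noteq> z then F z w / (cnj w - z)
      else Lim (at (z, w) within {(z', w'). cnj w' \<noteq> z'})
             (\<lambda>(z', w'). F z' w' / (cnj w' - z')))"

definition kernel_mat ::
  "(int \<Rightarrow> real) \<Rightarrow> (int \<Rightarrow> real) \<Rightarrow> int \<Rightarrow> int \<Rightarrow> complex \<Rightarrow> complex \<Rightarrow> complex^2^2" where
  "kernel_mat a b k n z w = (\<chi> i l. ext_quot (\<lambda>z' w'.
      (mat_adj (transfer a b k n w') ** j_mat ** transfer a b k n z' - j_mat) $ i $ l) z w)"

definition kernel_fn ::
  "(int \<Rightarrow> real) \<Rightarrow> (int \<Rightarrow> real) \<Rightarrow> int \<Rightarrow> int \<Rightarrow> complex \<Rightarrow> complex \<Rightarrow> complex" where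
  "kernel_fn a b k n z w = sesq_form (kernel_mat a b k n z w) (vector [1, 0]) (vector [1, 0])"

text \<open>For real \<open>\<xi>\<close> the following two quantities have real values (entries); they are kept in
  complex types so that no real parts have to be taken.\<close>

definition tau :: "(int \<Rightarrow> real) \<Rightarrow> (int \<Rightarrow> real) \<Rightarrow> real \<Rightarrow> int \<Rightarrow> complex" where
  "tau a b \<xi> n = trace (kernel_mat a b 0 n (of_real \<xi>) (of_real \<xi>))"

definition vvec :: "(int \<Rightarrow> real) \<Rightarrow> (int \<Rightarrow> real) \<Rightarrow> real \<Rightarrow> int \<Rightarrow> complex^2" where
  "vvec a b \<xi> k = matrix_inv (transfer a b 0 k (of_real \<xi>)) *v vector [1, 0]"

definition H_ring :: "complex \<Rightarrow> complex^2^2" where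
  "H_ring \<eta> = (1 / (1 + (cmod \<eta>)\<^sup>2)) *\<^sub>R
     vector [vector [1, - of_real (Re \<eta>)],
             vector [- of_real (Re \<eta>), of_real ((cmod \<eta>)\<^sup>2)]]"

definition h_eta :: "complex \<Rightarrow> real" where
  "h_eta \<eta> = Im \<eta> / (1 + (cmod \<eta>)\<^sup>2)"

end

theory Submission
  imports Defs "HOL-Complex_Analysis.Complex_Analysis"
begin

text \<open>Let \<open>\<Phi> z n\<close> denote the transfer matrix from \<open>0\<close> to \<open>n\<close>, and look at it from the base
  point: \<open>M n s = (\<Phi> \<xi> n)\<inverse> \<Phi> (\<xi> + s) n\<close>, which is \<open>rel_fund \<xi> n s\<close> below.  Since \<open>\<Phi> \<xi> n\<close>
  is real and symplectic, it drops out of the kernel, which becomes a quadratic form at the vector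
  \<open>vvec\<close> in the matrix \<open>M n s (M k s)\<inverse>\<close> (\<open>kernel_fn_jform\<close>).  So the theorem follows once one
  knows the single limit \<open>M n (z / \<tau> n) \<longlonglongrightarrow> exp (z j H) = cos (h z) + sin (h z) j H / h\<close>,
  locally uniformly in \<open>z\<close>, where \<open>H\<close> is \<open>H_ring \<eta>\<close> and \<open>h = h_eta \<eta>\<close> (\<open>rel_fund_limit\<close>).
  The limit is a one-parameter group, named \<open>rot\<close> below with the factor \<open>h\<close> scaled away.  The limits
  at the indices \<open>n l\<close> and \<open>k l\<close>, at times \<open>z / (1 - \<sigma>)\<close> and \<open>\<sigma> z / (1 - \<sigma>)\<close>, therefore
  combine to the limit at time \<open>z\<close>, whose quadratic form is the sine quotient (\<open>jform_rot\<close>).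

  The limit of \<open>M n (z / \<tau> n)\<close> rests on three facts.

  First, \<open>M n\<close> solves a discrete canonical system whose total mass is \<open>\<tau> n\<close>, hence
  \<open>M n (z / \<tau> n)\<close> is bounded by \<open>exp (2 |z|)\<close> and the family is normal.

  Second, the normal limit of \<open>m_plus\<close> at \<open>\<xi>\<close> upgrades to \<open>m_plus (\<xi> + z / \<tau> n) \<longlonglongrightarrow> \<eta>\<close> for
  every \<open>z\<close> in the upper half-plane: a limit of the rescaled functions is holomorphic there and is
  already known on the imaginary axis (\<open>herglotz_rescaling\<close>).  Here \<open>\<tau> n \<longlonglongrightarrow> \<infinity>\<close> is the limit-point
  condition at \<open>+\<infinity>\<close>.

  Third, there is a rigidity statement, which takes the place of the uniqueness theorem for canonical
  systems.  Let \<open>(f1, f2)\<close> be a limit of \<open>M n (z / \<tau> n)\<close> applied to \<open>(\<eta>, 1)\<close>, and call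
  \<open>Im (x cnj y)\<close> the flux of a vector \<open>(x, y)\<close>.  On and below the real axis the flux of
  \<open>(f1, f2)\<close> is at least \<open>Im \<eta>\<close>, because there the canonical system does not decrease it.  Above the axis it
  is still nonnegative, because there \<open>(\<eta>, 1)\<close> is the limit of the Weyl vectors \<open>(m_plus, 1)\<close>, whose flux
  remains nonnegative for all \<open>n\<close>.  Thus \<open>f2\<close> has no zeros, \<open>f1 / f2\<close> is an entire function with
  nonnegative imaginary part, and Liouville's theorem gives \<open>f1 = \<eta> f2\<close>; being zero-free of
  exponential type, \<open>f2\<close> is an exponential \<open>exp (\<kappa> z)\<close> (\<open>positive_flux_rigidity\<close>).  Determinant one
  and reality of \<open>M n\<close> make \<open>\<kappa>\<close> imaginary, and the trace normalisation of the canonical system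
  makes it \<open>\<i> h\<close>.  Hence \<open>(\<eta>, 1)\<close> and its conjugate are eigenvectors of the limit with eigenvalues
  \<open>exp (\<plusminus>\<i> h z)\<close>, which determines the limit.\<close>

no_notation fps_nth (infixl "$" 75)

section \<open>Two-by-two matrices and transfer matrices\<close>

definition mat2 :: "complex \<Rightarrow> complex \<Rightarrow> complex \<Rightarrow> complex \<Rightarrow> complex^2^2" where
  "mat2 p q r s = vector [vector [p, q], vector [r, s]]"

lemma mat2_nth [simp]:
  "mat2 p q r s $ 1 $ 1 = p" "mat2 p q r s $ 1 $ 2 = q"
  "mat2 p q r s $ 2 $ 1 = r" "mat2 p q r s $ 2 $ 2 = s"
  by (simp_all add: mat2_def)

lemma mat_mult_nth2:
  "((A :: complex^2^2) ** B) $ i $ l = A $ i $ 1 * B $ 1 $ l + A $ i $ 2 * B $ 2 $ l"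
  by (simp add: matrix_matrix_mult_def sum_2)

lemma mat_vec_nth2:
  "((A :: complex^2^2) *v x) $ i = A $ i $ 1 * x $ 1 + A $ i $ 2 * x $ 2"
  by (simp add: matrix_vector_mult_def sum_2)

lemma mat2_eqI:
  "A $ 1 $ 1 = B $ 1 $ 1 \<Longrightarrow> A $ 1 $ 2 = B $ 1 $ 2 \<Longrightarrow> A $ 2 $ 1 = B $ 2 $ 1 \<Longrightarrow> A $ 2 $ 2 = B $ 2 $ 2
    \<Longrightarrow> A = (B :: complex^2^2)"
  by (simp add: vec_eq_iff forall_2)

lemma vec2_eqI: "x $ 1 = y $ 1 \<Longrightarrow> x $ 2 = y $ 2 \<Longrightarrow> x = (y :: complex^2)"
  by (simp add: vec_eq_iff forall_2)

lemma mat1_nth2 [simp]: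
  "(mat 1 :: complex^2^2) $ 1 $ 1 = 1" "(mat 1 :: complex^2^2) $ 1 $ 2 = 0"
  "(mat 1 :: complex^2^2) $ 2 $ 1 = 0" "(mat 1 :: complex^2^2) $ 2 $ 2 = 1"
  by (simp_all add: mat_def)

lemma j_mat_nth [simp]:
  "j_mat $ 1 $ 1 = 0" "j_mat $ 1 $ 2 = -1" "j_mat $ 2 $ 1 = 1" "j_mat $ 2 $ 2 = 0"
  by (simp_all add: j_mat_def)

text \<open>The adjugate.  It serves as the inverse of matrices of determinant one, because its entries are,
  up to sign, those of the matrix.\<close>

definition adj2 :: "complex^2^2 \<Rightarrow> complex^2^2" where
  "adj2 M = mat2 (M $ 2 $ 2) (- (M $ 1 $ 2)) (- (M $ 2 $ 1)) (M $ 1 $ 1)"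

lemma adj2_nth [simp]:
  "adj2 M $ 1 $ 1 = M $ 2 $ 2" "adj2 M $ 1 $ 2 = - (M $ 1 $ 2)"
  "adj2 M $ 2 $ 1 = - (M $ 2 $ 1)" "adj2 M $ 2 $ 2 = M $ 1 $ 1"
  by (simp_all add: adj2_def)

lemma adj2_left: "det M = 1 \<Longrightarrow> adj2 M ** M = mat 1"
  by (intro mat2_eqI) (simp_all add: mat_mult_nth2 det_2 algebra_simps)

lemma adj2_right: "det M = 1 \<Longrightarrow> M ** adj2 M = mat 1"
  by (intro mat2_eqI) (simp_all add: mat_mult_nth2 det_2 algebra_simps)

lemma det_adj2 [simp]: "det (adj2 M) = det M"
  by (simp add: det_2 algebra_simps)

lemma adj2_mult: "adj2 (A ** B) = adj2 B ** adj2 A"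
  by (intro mat2_eqI) (simp_all add: mat_mult_nth2 algebra_simps)

lemma matrix_inv_det1:
  assumes "det M = 1"
  shows "matrix_inv M = adj2 M"
proof -
  have "M ** matrix_inv M = mat 1 \<and> matrix_inv M ** M = mat 1"
    unfolding matrix_inv_def
    by (rule someI[of _ "adj2 M"]) (simp add: adj2_left adj2_right assms)
  then have "adj2 M ** (M ** matrix_inv M) = adj2 M"
    by simp
  then show ?thesis
    by (simp add: matrix_mul_assoc adj2_left assms)
qed

text \<open>The one-step transfer matrix: it maps \<open>(u m, - a (m - 1) u (m - 1))\<close> to
  \<open>(u (m + 1), - a m u m)\<close>.  The weight \<open>- a\<close> in the second component makes its determinant one.\<close>

definition step_mat :: "(int \<Rightarrow> real) \<Rightarrow> (int \<Rightarrow> real) \<Rightarrow> complex \<Rightarrow> int \<Rightarrow> complex^2^2" where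
  "step_mat a b z m = mat2 ((z - b m) / a m) (1 / a m) (- a m) 0"

primrec fund_up :: "(int \<Rightarrow> real) \<Rightarrow> (int \<Rightarrow> real) \<Rightarrow> complex \<Rightarrow> nat \<Rightarrow> complex^2^2" where
  "fund_up a b z 0 = mat 1"
| "fund_up a b z (Suc n) = step_mat a b z (int (Suc n)) ** fund_up a b z n"

primrec fund_down :: "(int \<Rightarrow> real) \<Rightarrow> (int \<Rightarrow> real) \<Rightarrow> complex \<Rightarrow> nat \<Rightarrow> complex^2^2" where
  "fund_down a b z 0 = mat 1"
| "fund_down a b z (Suc n) = adj2 (step_mat a b z (- int n)) ** fund_down a b z n"

text \<open>The transfer matrix from \<open>0\<close> to an arbitrary integer.  Negative indices occur, because the sequence
  \<open>k\<close> is only bounded below; there one multiplies by inverses.\<close>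

definition fund :: "(int \<Rightarrow> real) \<Rightarrow> (int \<Rightarrow> real) \<Rightarrow> complex \<Rightarrow> int \<Rightarrow> complex^2^2" where
  "fund a b z n = (if 0 \<le> n then fund_up a b z (nat n) else fund_down a b z (nat (- n)))"

lemma int_zigzag_induct [case_names zero up down]:
  assumes "P 0" "\<And>n. P n \<Longrightarrow> P (n + 1)" "\<And>n. P (n + 1) \<Longrightarrow> P n"
  shows "P (n :: int)"
proof (induction n rule: int_induct[of _ 0])
  case base
  show ?case by (rule assms(1))
next
  case (step1 i)
  then show ?case by (intro assms(2))
next
  case (step2 i)
  then show ?case using assms(3)[of "i - 1"] by simp
qed

locale jacobi_coeffs =
  fixes a b :: "int \<Rightarrow> real"
  assumes a_pos: "a m > 0"
begin

lemma a_nz [simp]: "a m \<noteq> 0"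
  using a_pos[of m] by simp

abbreviation \<Phi> :: "complex \<Rightarrow> int \<Rightarrow> complex^2^2" where
  "\<Phi> \<equiv> fund a b"

lemma det_step: "det (step_mat a b z m) = 1"
  by (simp add: step_mat_def det_2)

lemma fund_0 [simp]: "\<Phi> z 0 = mat 1"
  by (simp add: fund_def)

lemma fund_step: "\<Phi> z (n + 1) = step_mat a b z (n + 1) ** \<Phi> z n"
proof (cases "n \<ge> 0")
  case True
  then have "nat (n + 1) = Suc (nat n)" "int (Suc (nat n)) = n + 1" by auto
  with True show ?thesis by (simp add: fund_def del: of_nat_Suc)
next
  case False
  then obtain m where m: "n = - int (Suc m)"
    by (metis int_cases linorder_not_less of_nat_0_le_iff)
  have *: "fund_down a b z m = \<Phi> z (n + 1)"
    by (cases "m = 0") (simp_all add: fund_def m)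
  have "nat (- n) = Suc m" using m by simp
  then have "\<Phi> z n = adj2 (step_mat a b z (n + 1)) ** \<Phi> z (n + 1)"
    using False m * by (simp add: fund_def)
  then show ?thesis
    by (simp add: matrix_mul_assoc adj2_right det_step)
qed

lemma fund_step1:
  "\<Phi> z (n + 1) $ 1 $ l = ((z - b (n + 1)) * \<Phi> z n $ 1 $ l + \<Phi> z n $ 2 $ l) / a (n + 1)"
  by (simp add: fund_step mat_mult_nth2 step_mat_def add_divide_distrib)

lemma fund_step2: "\<Phi> z (n + 1) $ 2 $ l = - a (n + 1) * \<Phi> z n $ 1 $ l"
  by (simp add: fund_step mat_mult_nth2 step_mat_def)

lemma fund_back1: "\<Phi> z n $ 1 $ l = - \<Phi> z (n + 1) $ 2 $ l / a (n + 1)"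
  by (simp add: fund_step2)

lemma fund_back2:
  "\<Phi> z n $ 2 $ l = of_real (a (n + 1)) * \<Phi> z (n + 1) $ 1 $ l - (z - of_real (b (n + 1))) * \<Phi> z n $ 1 $ l"
  by (simp add: fund_step1)

lemma det_fund [simp]: "det (\<Phi> z n) = 1"
proof (induction n rule: int_zigzag_induct)
  case (down n)
  then show ?case by (simp add: fund_step det_mul det_step)
qed (simp_all add: fund_step det_mul det_step)

lemma det_fund_entries: "\<Phi> z n $ 1 $ 1 * \<Phi> z n $ 2 $ 2 - \<Phi> z n $ 1 $ 2 * \<Phi> z n $ 2 $ 1 = 1"
  using det_fund[of z n] by (simp only: det_2)

text \<open>Induction for statements about single entries: the recursion mixes the rows of \<open>\<Phi> z n\<close>, but not
  its columns.\<close>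

lemma fund_entry_induct:
  assumes "\<And>l. P 0 1 l" "\<And>l. P 0 2 l"
    "\<And>n l. P n 1 l \<Longrightarrow> P n 2 l \<Longrightarrow> P (n + 1) 1 l \<and> P (n + 1) 2 l"
    "\<And>n l. P (n + 1) 1 l \<Longrightarrow> P (n + 1) 2 l \<Longrightarrow> P n 1 l \<and> P n 2 l"
  shows "P (n::int) (i::2) (l::2)"
proof -
  have "P n 1 l \<and> P n 2 l"
  proof (induction n rule: int_zigzag_induct)
    case zero
    show ?case using assms(1,2) by blast
  next
    case (up n)
    then show ?case using assms(3)[of n l] by blast
  next
    case (down n)
    then show ?case using assms(4)[of n l] by blast
  qed
  then show ?thesis by (metis exhaust_2)
qed

lemma cnj_fund: "cnj (\<Phi> z n $ i $ l) = \<Phi> (cnj z) n $ i $ l"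
proof (induction n i l rule: fund_entry_induct)
  case (1 l) then show ?case using exhaust_2[of l] by auto
next
  case (2 l) then show ?case using exhaust_2[of l] by auto
next
  case (3 n l) then show ?case by (simp add: fund_step1 fund_step2)
next
  case (4 n l)
  have "cnj (\<Phi> z n $ 1 $ l) = \<Phi> (cnj z) n $ 1 $ l"
    using 4 by (simp add: fund_back1)
  with 4 show ?case by (simp add: fund_back2[of _ n])
qed

lemma fund_field_differentiable:
  "(\<lambda>z. \<Phi> z n $ i $ l) field_differentiable (at z)"
proof (induction n i l rule: fund_entry_induct)
  case (1 l) then show ?case by simp
next
  case (2 l) then show ?case by simp
next
  case (3 n l) then show ?case
    unfolding fund_step1 fund_step2 by (auto intro!: derivative_intros)
next
  case (4 n l)
  have *: "(\<lambda>z. \<Phi> z n $ 1 $ l) field_differentiable (at z)"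
    unfolding fund_back1 using 4 by (auto intro!: derivative_intros)
  have "(\<lambda>z. \<Phi> z n $ 2 $ l) field_differentiable (at z)"
    unfolding fund_back2 using 4 * by (auto intro!: derivative_intros)
  with * show ?case by blast
qed

lemma fund_holomorphic: "(\<lambda>z. \<Phi> z n $ i $ l) holomorphic_on S"
  using fund_field_differentiable holomorphic_on_def field_differentiable_at_within by blast

lemma continuous_fund [continuous_intros]:
  "continuous_on T f \<Longrightarrow> continuous_on T (\<lambda>x. \<Phi> (f x) n $ i $ l)"
  by (rule continuous_on_compose2[OF holomorphic_on_imp_continuous_on[OF fund_holomorphic[of n i l UNIV]]]) auto

lemma solution_step:
  fixes u :: "int \<Rightarrow> complex"
  assumes "jacobi a b u = (\<lambda>m. z * u m)"
  shows "vector [u (n + 2), - of_real (a (n + 1)) * u (n + 1)]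
    = step_mat a b z (n + 1) *v (vector [u (n + 1), - of_real (a n) * u n] :: complex^2)"
proof -
  have *: "of_real (a n) * u n + of_real (b (n + 1)) * u (n + 1) + of_real (a (n + 1)) * u (n + 2)
      = z * u (n + 1)"
    using fun_cong[OF assms, of "n + 1"] by (simp add: jacobi_def algebra_simps)
  have "u (n + 2) = ((z - of_real (b (n + 1))) * u (n + 1) - of_real (a n) * u n) / of_real (a (n + 1))"
    using * by (simp add: field_simps)
  then show ?thesis
    by (intro vec2_eqI) (simp_all add: mat_vec_nth2 step_mat_def diff_divide_distrib left_diff_distrib)
qed

lemma solution_fund:
  fixes u :: "int \<Rightarrow> complex"
  assumes "jacobi a b u = (\<lambda>m. z * u m)"
  shows "vector [u (n + 1), - of_real (a n) * u n] = \<Phi> z n *v (vector [u 1, - of_real (a 0) * u 0] :: complex^2)"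
proof (induction n rule: int_zigzag_induct)
  case zero
  then show ?case by simp
next
  case (up n)
  then show ?case using solution_step[OF assms, of n]
    by (simp add: fund_step matrix_vector_mul_assoc add.assoc)
next
  case (down n)
  let ?A = "step_mat a b z (n + 1)"
  have "?A *v vector [u (n + 1), - of_real (a n) * u n] = ?A *v (\<Phi> z n *v vector [u 1, - of_real (a 0) * u 0])"
    using down solution_step[OF assms, of n] by (simp add: fund_step matrix_vector_mul_assoc add.assoc)
  then have "adj2 ?A *v (?A *v vector [u (n + 1), - of_real (a n) * u n])
     = adj2 ?A *v (?A *v (\<Phi> z n *v vector [u 1, - of_real (a 0) * u 0]))"
    by (rule arg_cong)
  then show ?case
    by (simp only: matrix_vector_mul_assoc[of "adj2 ?A"] adj2_left[OF det_step] matrix_vector_mul_lid)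
qed

text \<open>Every vector is the initial vector of a solution.  This makes the matrix in the definition of
  \<open>transfer\<close> unique.\<close>

lemma solution_of_fund:
  fixes u :: "int \<Rightarrow> complex"
  assumes "\<And>n. u n = (\<Phi> z (n - 1) *v x) $ 1"
  shows "jacobi a b u = (\<lambda>m. z * u m)"
    and "vector [u (n + 1), - of_real (a n) * u n] = \<Phi> z n *v x"
proof -
  have *: "- of_real (a n) * u n = (\<Phi> z n *v x) $ 2" for n
    using fund_step2[of z "n - 1"] by (simp add: assms mat_vec_nth2 algebra_simps)
  show "vector [u (n + 1), - of_real (a n) * u n] = \<Phi> z n *v x"
    by (rule vec2_eqI) (use * in \<open>simp_all add: assms\<close>)
  show "jacobi a b u = (\<lambda>m. z * u m)"
  proof
    fix m
    have s: "of_real (a m) * \<Phi> z m $ 1 $ l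
        = (z - of_real (b m)) * \<Phi> z (m - 1) $ 1 $ l + \<Phi> z (m - 1) $ 2 $ l" for l
      using fund_step1[of z "m - 1" l] by simp
    have "of_real (a m) * u (m + 1)
        = (of_real (a m) * \<Phi> z m $ 1 $ 1) * x $ 1 + (of_real (a m) * \<Phi> z m $ 1 $ 2) * x $ 2"
      by (simp add: assms mat_vec_nth2 algebra_simps)
    also have "\<dots> = (z - of_real (b m)) * u m + (\<Phi> z (m - 1) *v x) $ 2"
      unfolding s by (simp add: assms mat_vec_nth2 algebra_simps)
    finally have "of_real (a m) * u (m + 1) = (z - of_real (b m)) * u m + (\<Phi> z (m - 1) *v x) $ 2" .
    then show "jacobi a b u m = z * u m"
      using *[of "m - 1"] unfolding jacobi_def by algebra
  qed
qed

lemma transfer_eq: "transfer a b k n z = \<Phi> z n ** adj2 (\<Phi> z k)"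
  unfolding transfer_def
proof (rule the_equality)
  show "\<forall>u. jacobi a b u = (\<lambda>m. z * u m) \<longrightarrow>
      (\<Phi> z n ** adj2 (\<Phi> z k)) *v vector [u (k + 1), - of_real (a k) * u k]
        = vector [u (n + 1), - of_real (a n) * u n]"
  proof (intro allI impI)
    fix u assume u: "jacobi a b u = (\<lambda>m. z * u m)"
    show "(\<Phi> z n ** adj2 (\<Phi> z k)) *v vector [u (k + 1), - of_real (a k) * u k]
        = vector [u (n + 1), - of_real (a n) * u n]"
      unfolding solution_fund[OF u, of n] solution_fund[OF u, of k]
      by (simp add: matrix_vector_mul_assoc flip: matrix_mul_assoc) (simp add: adj2_left)
  qed
next
  fix M :: "complex^2^2"
  assume M: "\<forall>u. jacobi a b u = (\<lambda>m. z * u m) \<longrightarrow>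
      M *v vector [u (k + 1), - of_real (a k) * u k] = vector [u (n + 1), - of_real (a n) * u n]"
  have "(M ** \<Phi> z k) *v x = \<Phi> z n *v x" for x
  proof -
    note sol = solution_of_fund[of "\<lambda>n. (\<Phi> z (n - 1) *v x) $ 1" z x, OF refl]
    show ?thesis
      using M[rule_format, OF sol(1)] unfolding sol(2) by (simp add: matrix_vector_mul_assoc)
  qed
  then have "M ** \<Phi> z k = \<Phi> z n"
    by (simp add: matrix_eq)
  then show "M = \<Phi> z n ** adj2 (\<Phi> z k)"
    by (metis adj2_right det_fund matrix_mul_assoc matrix_mul_rid)
qed

end

section \<open>Quotients extended by continuity\<close>

text \<open>Every point of the diagonal \<open>cnj w = z\<close> is a limit point of its complement, so a limit along the
  complement is unique.\<close>

lemma ext_quot_diagonal: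
  assumes diag: "cnj w = z"
    and lim: "((\<lambda>(z', w'). F z' w' / (cnj w' - z')) \<longlongrightarrow> L) (at (z, w) within {(z', w'). cnj w' \<noteq> z'})"
  shows "ext_quot F z w = L"
proof -
  let ?S = "{(z', w'). cnj w' \<noteq> (z' :: complex)}"
  have "(z, w) islimpt ?S"
    unfolding islimpt_approachable
  proof (intro allI impI)
    fix e :: real assume e: "e > 0"
    have "dist (z + of_real (e/2), w) (z, w) < e"
      using e by (simp add: dist_Pair_Pair dist_norm)
    then show "\<exists>p\<in>?S. p \<noteq> (z, w) \<and> dist p (z, w) < e"
      using e diag by (intro bexI[of _ "(z + of_real (e/2), w)"]) auto
  qed
  then have "at (z, w) within ?S \<noteq> bot"
    by (simp add: trivial_limit_within)
  then have "Lim (at (z, w) within ?S) (\<lambda>(z', w'). F z' w' / (cnj w' - z')) = L"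
    using lim by (rule tendsto_Lim)
  with diag show ?thesis by (simp add: ext_quot_def)
qed

lemma ext_quot_eq:
  assumes F: "\<And>z w. F z w = (cnj w - z) * G z w"
    and cont: "continuous_on UNIV (\<lambda>p. G (fst p) (snd p))"
  shows "ext_quot F z w = G z w"
proof (cases "cnj w = z")
  case False
  then show ?thesis by (simp add: ext_quot_def F)
next
  case True
  let ?S = "{(z', w'). cnj w' \<noteq> (z' :: complex)}"
  have "((\<lambda>p. G (fst p) (snd p)) \<longlongrightarrow> G z w) (at (z, w) within ?S)"
    using cont[unfolded continuous_on_def, rule_format, of "(z, w)"]
    by (auto intro: tendsto_within_subset)
  then have "((\<lambda>(z', w'). F z' w' / (cnj w' - z')) \<longlongrightarrow> G z w) (at (z, w) within ?S)"
    by (rule Lim_transform_within[of _ _ _ _ 1]) (auto simp: F)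
  with True show ?thesis by (rule ext_quot_diagonal)
qed

lemma ext_quot_sin_diagonal:
  assumes "cnj w = z"
  shows "ext_quot (\<lambda>z' w'. sin (cnj w' - z')) z w = 1"
proof (rule ext_quot_diagonal[OF assms])
  let ?S = "{(z', w'). cnj w' \<noteq> (z' :: complex)}"
  have "((\<lambda>x :: complex. sin x / x) \<longlongrightarrow> 1) (at 0)"
    using DERIV_sin[of "0 :: complex"] by (simp add: DERIV_def)
  moreover have "filterlim (\<lambda>p. cnj (snd p) - fst p) (at 0) (at (z, w) within ?S)"
    unfolding filterlim_at
  proof
    have "((\<lambda>p. cnj (snd p) - fst p) \<longlongrightarrow> cnj (snd (z, w)) - fst (z, w)) (at (z, w) within ?S)"
      by (intro tendsto_intros)
    then show "((\<lambda>p. cnj (snd p) - fst p) \<longlongrightarrow> 0) (at (z, w) within ?S)"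
      using assms by simp
    show "\<forall>\<^sub>F p in at (z, w) within ?S. cnj (snd p) - fst p \<in> UNIV \<and> cnj (snd p) - fst p \<noteq> 0"
      unfolding eventually_at_filter by (intro always_eventually) auto
  qed
  ultimately show "((\<lambda>(z', w'). sin (cnj w' - z') / (cnj w' - z')) \<longlongrightarrow> 1) (at (z, w) within ?S)"
    unfolding case_prod_beta by (rule filterlim_compose)
qed

section \<open>The Christoffel--Darboux formula\<close>

text \<open>The sum from \<open>k\<close> to \<open>n - 1\<close> with the orientation of an integral: at most one of the two sums has any
  terms, and the sign is reversed for \<open>n < k\<close>.  This keeps the recursion \<open>signed_sum_step\<close>
  valid for all integers.\<close>

definition signed_sum :: "int \<Rightarrow> int \<Rightarrow> (int \<Rightarrow> 'a::ab_group_add) \<Rightarrow> 'a" where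
  "signed_sum k n f = (\<Sum>m\<in>{k..<n}. f m) - (\<Sum>m\<in>{n..<k}. f m)"

lemma signed_sum_same [simp]: "signed_sum k k f = 0"
  by (simp add: signed_sum_def)

lemma signed_sum_step: "signed_sum k (n + 1) f = signed_sum k n f + f n"
proof (cases "k \<le> n")
  case True
  then have "{k..<n + 1} = insert n {k..<n}" "{n + 1..<k} = {}" "{n..<k} = {}" by auto
  then show ?thesis by (simp add: signed_sum_def)
next
  case False
  then have "{n..<k} = insert n {n + 1..<k}" "{k..<n + 1} = {}" "{k..<n} = {}" by auto
  then show ?thesis by (simp add: signed_sum_def)
qed

lemma signed_sum_cong: "(\<And>m. f m = g m) \<Longrightarrow> signed_sum k n f = signed_sum k n g"
  by (simp add: signed_sum_def)

lemma of_real_signed_sum: "of_real (signed_sum k n f) = signed_sum k n (\<lambda>m. of_real (f m))"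
  by (simp add: signed_sum_def)

lemma signed_sum_add: "signed_sum k n f + signed_sum k n g = signed_sum k n (\<lambda>m. f m + g m)"
  by (simp add: signed_sum_def sum.distrib)

context jacobi_coeffs
begin

abbreviation T :: "int \<Rightarrow> complex \<Rightarrow> int \<Rightarrow> complex^2^2" where
  "T k z n \<equiv> \<Phi> z n ** adj2 (\<Phi> z k)"

lemma T_step1: "T k z (n + 1) $ 1 $ l
    = ((z - of_real (b (n + 1))) * T k z n $ 1 $ l + T k z n $ 2 $ l) / of_real (a (n + 1))"
  unfolding mat_mult_nth2[of "\<Phi> z _"] fund_step1 fund_step2
  by (simp add: field_simps)

lemma T_step2: "T k z (n + 1) $ 2 $ l = - of_real (a (n + 1)) * T k z n $ 1 $ l"
  unfolding mat_mult_nth2[of "\<Phi> z _"] fund_step1 fund_step2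
  by (simp add: algebra_simps)

definition cd_sum :: "int \<Rightarrow> int \<Rightarrow> complex \<Rightarrow> complex \<Rightarrow> 2 \<Rightarrow> 2 \<Rightarrow> complex" where
  "cd_sum k n z w i l = signed_sum k n (\<lambda>m. cnj (T k w m $ 1 $ i) * T k z m $ 1 $ l)"

lemma j_form_nth:
  "(mat_adj B ** j_mat ** A) $ i $ l = cnj (B $ 2 $ i) * A $ 1 $ l - cnj (B $ 1 $ i) * A $ 2 $ l"
  by (simp add: mat_mult_nth2 mat_adj_def)

text \<open>One step of the recursion changes \<open>T(w)\<^sup>* j T(z)\<close> by \<open>cnj w - z\<close> times the product of the first
  rows, so the numerator of the kernel telescopes.  The quotient extends continuously to the diagonal
  because it is this finite sum.\<close>

lemma christoffel_darboux:
  "(mat_adj (T k w n) ** j_mat ** T k z n - j_mat) $ i $ l = (cnj w - z) * cd_sum k n z w i l"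
proof -
  have *: "(mat_adj (T k w (n + 1)) ** j_mat ** T k z (n + 1)) $ i $ l
    = (mat_adj (T k w n) ** j_mat ** T k z n) $ i $ l
      + (cnj w - z) * (cnj (T k w n $ 1 $ i) * T k z n $ 1 $ l)" for n
    unfolding j_form_nth T_step1 T_step2 by (simp add: field_simps)
  define F where "F n = (mat_adj (T k w n) ** j_mat ** T k z n - j_mat) $ i $ l" for n
  have step: "F (n + 1) = F n + (cnj w - z) * (cnj (T k w n $ 1 $ i) * T k z n $ 1 $ l)" for n
    unfolding F_def using *[of n] by simp
  have "F n = (cnj w - z) * cd_sum k n z w i l"
  proof (induction n rule: int_induct[of _ k])
    case base
    have "mat_adj (mat 1) ** j_mat ** mat 1 - j_mat = 0"
      by (intro mat2_eqI) (simp_all add: mat_mult_nth2 mat_adj_def)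
    then show ?case
      by (simp add: F_def cd_sum_def adj2_right)
  next
    case (step1 n)
    then show ?case
      using step[of n] by (simp add: cd_sum_def signed_sum_step distrib_left)
  next
    case (step2 n)
    then show ?case
      using step[of "n - 1"] signed_sum_step[of k "n - 1" "\<lambda>m. cnj (T k w m $ 1 $ i) * T k z m $ 1 $ l"]
      by (simp add: cd_sum_def distrib_left)
  qed
  then show ?thesis by (simp add: F_def)
qed

lemma continuous_cd_sum:
  assumes "continuous_on S f" "continuous_on S g"
  shows "continuous_on S (\<lambda>p. cd_sum k n (f p) (g p) i l)"
  unfolding cd_sum_def signed_sum_def mat_mult_nth2 adj2_nth
  using exhaust_2[of i] exhaust_2[of l] assms
  by (elim disjE) (auto intro!: continuous_intros)

lemma kernel_mat_eq: "kernel_mat a b k n z w $ i $ l = cd_sum k n z w i l"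
  unfolding kernel_mat_def transfer_eq vec_lambda_beta
  by (rule ext_quot_eq)
     (simp_all only: christoffel_darboux continuous_cd_sum continuous_on_fst continuous_on_snd continuous_on_id)

lemma kernel_fn_eq: "kernel_fn a b k n z w = cd_sum k n z w 1 1"
  by (simp add: kernel_fn_def sesq_form_def sum_2 mat_vec_nth2 kernel_mat_eq)

lemma fund_real: "cnj (\<Phi> (of_real x) n $ i $ l) = \<Phi> (of_real x) n $ i $ l"
  by (simp add: cnj_fund)

text \<open>The quantity \<open>tau\<close> as a real number.  It is the total mass, or length, of the canonical system
  up to the index \<open>n\<close>.\<close>

definition len :: "real \<Rightarrow> int \<Rightarrow> real" where
  "len \<xi> n = signed_sum 0 n (\<lambda>m. (cmod (\<Phi> \<xi> m $ 1 $ 1))\<^sup>2 + (cmod (\<Phi> \<xi> m $ 1 $ 2))\<^sup>2)"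

lemma tau_eq: "tau a b \<xi> n = of_real (len \<xi> n)"
proof -
  have "adj2 (mat 1) = mat 1"
    by (intro mat2_eqI) simp_all
  then show ?thesis
  unfolding tau_def trace_def len_def sum_2 kernel_mat_eq cd_sum_def of_real_signed_sum signed_sum_add
    by (intro signed_sum_cong) (simp add: complex_norm_square[unfolded of_real_power] mult.commute)
qed

lemma len_0 [simp]: "len \<xi> 0 = 0"
  by (simp add: len_def)

lemma len_step: "len \<xi> (n + 1)
    = len \<xi> n + ((cmod (\<Phi> \<xi> n $ 1 $ 1))\<^sup>2 + (cmod (\<Phi> \<xi> n $ 1 $ 2))\<^sup>2)"
  by (simp add: len_def signed_sum_step)

lemma len_mono: "m \<le> n \<Longrightarrow> len \<xi> m \<le> len \<xi> n"
proof (induction n rule: int_ge_induct)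
  case (step n)
  have "len \<xi> n \<le> len \<xi> (n + 1)" by (simp add: len_step)
  with step show ?case by simp
qed simp

lemma vvec_eq: "vvec a b \<xi> k = vector [\<Phi> \<xi> k $ 2 $ 2, - (\<Phi> \<xi> k $ 2 $ 1)]"
proof -
  have "adj2 (mat 1) = mat 1"
    by (intro mat2_eqI) simp_all
  then show ?thesis
    by (intro vec2_eqI) (simp_all add: vvec_def transfer_eq matrix_inv_det1 mat_vec_nth2)
qed

subsection \<open>Transfer matrices seen from a real point\<close>

definition rel_fund :: "real \<Rightarrow> int \<Rightarrow> complex \<Rightarrow> complex^2^2" where
  "rel_fund \<xi> n s = adj2 (\<Phi> \<xi> n) ** \<Phi> (\<xi> + s) n"

lemma det_rel_fund [simp]: "det (rel_fund \<xi> n s) = 1"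
  by (simp add: rel_fund_def det_mul)

lemma fund_shift: "\<Phi> (\<xi> + s) n = \<Phi> \<xi> n ** rel_fund \<xi> n s"
  by (simp add: rel_fund_def matrix_mul_assoc adj2_right)

lemma rel_fund_index_0 [simp]: "rel_fund \<xi> 0 s = mat 1"
proof -
  have "adj2 (mat 1) = mat 1"
    by (intro mat2_eqI) simp_all
  then show ?thesis by (simp add: rel_fund_def)
qed

lemma rel_fund_at_0: "rel_fund \<xi> n 0 = mat 1"
  by (simp add: rel_fund_def adj2_left)

text \<open>This is the recursion of a canonical system: with \<open>r\<close> the first row of \<open>\<Phi> \<xi> n\<close>, the matrix is
  multiplied on the left by \<open>1 + s j r r\<^sup>T\<close>, where \<open>r r\<^sup>T\<close> has rank one and trace
  \<open>len \<xi> (n + 1) - len \<xi> n\<close>.\<close>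

lemma rel_fund_step:
  fixes \<xi> :: real and s :: complex
  defines "c \<equiv> (\<lambda>n l. s * (\<Phi> \<xi> n $ 1 $ 1 * rel_fund \<xi> n s $ 1 $ l + \<Phi> \<xi> n $ 1 $ 2 * rel_fund \<xi> n s $ 2 $ l))"
  shows "rel_fund \<xi> (n + 1) s $ 1 $ l = rel_fund \<xi> n s $ 1 $ l - c n l * \<Phi> \<xi> n $ 1 $ 2"
    and "rel_fund \<xi> (n + 1) s $ 2 $ l = rel_fund \<xi> n s $ 2 $ l + c n l * \<Phi> \<xi> n $ 1 $ 1"
proof -
  have r: "\<Phi> \<xi> n $ 1 $ 1 * rel_fund \<xi> n s $ 1 $ l + \<Phi> \<xi> n $ 1 $ 2 * rel_fund \<xi> n s $ 2 $ l
      = \<Phi> (\<xi> + s) n $ 1 $ l"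
    unfolding fund_shift by (simp add: mat_mult_nth2)
  show "rel_fund \<xi> (n + 1) s $ 1 $ l = rel_fund \<xi> n s $ 1 $ l - c n l * \<Phi> \<xi> n $ 1 $ 2"
    unfolding c_def r
    unfolding rel_fund_def mat_mult_nth2 adj2_nth fund_step1 fund_step2
    by (simp add: field_simps)
  show "rel_fund \<xi> (n + 1) s $ 2 $ l = rel_fund \<xi> n s $ 2 $ l + c n l * \<Phi> \<xi> n $ 1 $ 1"
    unfolding c_def r
    unfolding rel_fund_def mat_mult_nth2 adj2_nth fund_step1 fund_step2
    by (simp add: field_simps)
qed

lemma cnj_rel_fund: "cnj (rel_fund \<xi> n s $ i $ l) = rel_fund \<xi> n (cnj s) $ i $ l"
  using exhaust_2[of i] by (auto simp: rel_fund_def mat_mult_nth2 cnj_fund)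

lemma rel_fund_holomorphic: "(\<lambda>s. rel_fund \<xi> n (f s) $ i $ l) holomorphic_on S" if "f holomorphic_on S"
proof -
  have *: "(\<lambda>s. \<Phi> (\<xi> + f s) n $ i $ l) holomorphic_on S" for i l
    using holomorphic_on_compose[of "\<lambda>s. \<xi> + f s" S "\<lambda>z. \<Phi> z n $ i $ l"] fund_holomorphic
      holomorphic_on_add[OF holomorphic_on_const that]
    by (auto simp: o_def)
  show ?thesis unfolding rel_fund_def mat_mult_nth2 by (intro holomorphic_intros *)
qed

end

section \<open>The Weyl function of the half-line operator\<close>

lemma ell2_comb:
  assumes "u \<in> ell2" "v \<in> ell2"
  shows "(\<lambda>n. c * u n + v n) \<in> ell2"
proof -
  have "(\<lambda>n. 2 * (cmod c)\<^sup>2 * (cmod (u n))\<^sup>2 + 2 * (cmod (v n))\<^sup>2) summable_on UNIV"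
    using assms unfolding ell2_def by (intro summable_on_add summable_on_cmult_right) auto
  moreover have "(cmod (c * u n + v n))\<^sup>2 \<le> 2 * (cmod c)\<^sup>2 * (cmod (u n))\<^sup>2 + 2 * (cmod (v n))\<^sup>2" for n
  proof -
    have "(cmod (c * u n + v n))\<^sup>2 \<le> (cmod (c * u n) + cmod (v n))\<^sup>2"
      by (intro power_mono norm_triangle_ineq norm_ge_zero)
    also have "\<dots> \<le> 2 * (cmod (c * u n))\<^sup>2 + 2 * (cmod (v n))\<^sup>2"
      using zero_le_power2[of "cmod (c * u n) - cmod (v n)"] by (simp add: power2_eq_square algebra_simps)
    finally show ?thesis by (simp add: norm_mult power_mult_distrib)
  qed
  ultimately show ?thesis
    unfolding ell2_def mem_Collect_eq by (rule summable_on_comparison_test) auto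
qed

lemma ell2_cnj_mult_summable:
  assumes "u \<in> ell2" "v \<in> ell2"
  shows "(\<lambda>n. cnj (u n) * v n) summable_on UNIV"
proof (rule abs_summable_summable, rule Infinite_Sum.abs_summable_on_comparison_test')
  show "(\<lambda>n. (cmod (u n))\<^sup>2 + (cmod (v n))\<^sup>2) summable_on UNIV"
    using assms unfolding ell2_def by (intro summable_on_add) auto
  show "norm (cnj (u n) * v n) \<le> (cmod (u n))\<^sup>2 + (cmod (v n))\<^sup>2" for n
  proof -
    have "2 * (cmod (u n) * cmod (v n)) \<le> (cmod (u n))\<^sup>2 + (cmod (v n))\<^sup>2"
      using sum_squares_bound[of "cmod (u n)" "cmod (v n)"] by simp
    moreover have "0 \<le> cmod (u n) * cmod (v n)" by simp
    ultimately show ?thesis by (simp only: norm_mult complex_mod_cnj)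
  qed
qed

lemma has_sum_single:
  fixes c :: complex
  shows "((\<lambda>n. if n = m then c else 0) has_sum c) UNIV"
proof -
  have "((\<lambda>n. if n = m then c else 0) has_sum (\<Sum>n\<in>{m}. if n = m then c else 0)) {m}"
    by (rule has_sum_finite) simp
  then have "((\<lambda>n. if n = m then c else 0) has_sum c) {m}" by simp
  then show ?thesis
    by (rule has_sum_cong_neutral[THEN iffD1, rotated -1]) auto
qed

lemma delta_ell2: "delta m \<in> ell2"
proof -
  have "((\<lambda>n. (cmod (delta m n))\<^sup>2) has_sum (\<Sum>n\<in>{m}. (cmod (delta m n))\<^sup>2)) {m}"
    by (rule has_sum_finite) simp
  then have "((\<lambda>n. (cmod (delta m n))\<^sup>2) has_sum 1) {m}" by (simp add: delta_def)
  then have "((\<lambda>n. (cmod (delta m n))\<^sup>2) has_sum 1) UNIV"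
    by (rule has_sum_cong_neutral[THEN iffD1, rotated -1]) (auto simp: delta_def)
  then show ?thesis by (auto simp: ell2_def summable_on_def)
qed

lemma ell2_inner_delta: "ell2_inner (delta m) u = u m"
proof -
  have "(\<lambda>n. cnj (delta m n) * u n) = (\<lambda>n. if n = m then u m else 0)"
    by (auto simp: delta_def)
  then show ?thesis
    unfolding ell2_inner_def using has_sum_single[of m "u m"] by (simp add: infsumI)
qed

lemma ell2_half_line:
  assumes "\<And>n. n < 1 \<Longrightarrow> u n = 0" and bd: "\<And>N. (\<Sum>i<N. (cmod (u (int i + 1)))\<^sup>2) \<le> C"
  shows "u \<in> ell2"
proof -
  have "(\<lambda>n. (cmod (u n))\<^sup>2) summable_on UNIV"
  proof (rule nonneg_bounded_partial_sums_imp_summable_on)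
    show "\<forall>\<^sub>F F in finite_subsets_at_top UNIV. (\<Sum>n\<in>F. (cmod (u n))\<^sup>2) \<le> C"
    proof (rule eventually_finite_subsets_at_top_weakI)
      fix F :: "int set" assume F: "finite F"
      define N where "N = nat (Max (insert 0 F))"
      have sub: "n \<in> (\<lambda>i. int i + 1) ` {..<N}" if "n \<in> F" "n \<ge> 1" for n
      proof -
        have "n \<le> Max (insert 0 F)" using that F by (intro Max_ge) auto
        then show ?thesis using that by (intro image_eqI[of _ _ "nat (n - 1)"]) (auto simp: N_def)
      qed
      have "(\<Sum>n\<in>F. (cmod (u n))\<^sup>2) \<le> (\<Sum>n\<in>(\<lambda>i. int i + 1) ` {..<N}. (cmod (u n))\<^sup>2)"
      proof -
        have "1 \<le> i" if "u i \<noteq> 0" for i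
          using assms(1)[of i] that by force
        then have "(\<Sum>n\<in>F. (cmod (u n))\<^sup>2) = (\<Sum>n\<in>F \<inter> {1..}. (cmod (u n))\<^sup>2)"
          using F by (intro sum.mono_neutral_right) auto
        also have "\<dots> \<le> (\<Sum>n\<in>(\<lambda>i. int i + 1) ` {..<N}. (cmod (u n))\<^sup>2)"
          using sub by (intro sum_mono2) auto
        finally show ?thesis .
      qed
      also have "\<dots> = (\<Sum>i<N. (cmod (u (int i + 1)))\<^sup>2)"
        by (subst sum.reindex) (auto simp: inj_on_def)
      finally show "(\<Sum>n\<in>F. (cmod (u n))\<^sup>2) \<le> C" using bd[of N] by simp
    qed
  qed auto
  then show ?thesis by (simp add: ell2_def)
qed

text \<open>The quantity \<open>Im (x cnj y)\<close> is positive exactly if \<open>x / y\<close> lies in the open upper half-plane.  Unlike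
  the quotient it is continuous at \<open>y = 0\<close>.\<close>

definition flux :: "complex \<Rightarrow> complex \<Rightarrow> real" where
  "flux x y = Im (x * cnj y)"

context jacobi_coeffs
begin

text \<open>Green's identity for one step: the change of the flux is \<open>- Im z\<close> times the mass of the
  solution at the site that is passed.\<close>

lemma flux_step:
  "flux ((\<Phi> z (n + 1) *v x) $ 1) ((\<Phi> z (n + 1) *v x) $ 2)
    = flux ((\<Phi> z n *v x) $ 1) ((\<Phi> z n *v x) $ 2) - Im z * (cmod ((\<Phi> z n *v x) $ 1))\<^sup>2"
proof -
  let ?y = "\<Phi> z n *v x"
  have y: "\<Phi> z (n + 1) *v x = step_mat a b z (n + 1) *v ?y"
    by (simp add: fund_step matrix_vector_mul_assoc)
  have 1: "(\<Phi> z (n + 1) *v x) $ 1 = ((z - of_real (b (n + 1))) * ?y $ 1 + ?y $ 2) / of_real (a (n + 1))"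
    unfolding y by (simp add: mat_vec_nth2[of _ ?y] step_mat_def add_divide_distrib)
  have 2: "(\<Phi> z (n + 1) *v x) $ 2 = - of_real (a (n + 1)) * ?y $ 1"
    unfolding y by (simp add: mat_vec_nth2[of _ ?y] step_mat_def)
  have prd: "(\<Phi> z (n + 1) *v x) $ 1 * cnj ((\<Phi> z (n + 1) *v x) $ 2)
      = - ((z - of_real (b (n + 1))) * (?y $ 1 * cnj (?y $ 1))) - ?y $ 2 * cnj (?y $ 1)"
    unfolding 1 2 by (simp add: field_simps)
  show ?thesis
    unfolding flux_def prd
    by (simp add: complex_mult_cnj cmod_power2 algebra_simps)
qed

lemma flux_sum:
  "flux ((\<Phi> z (int N) *v x) $ 1) ((\<Phi> z (int N) *v x) $ 2)
    = flux (x $ 1) (x $ 2) - Im z * (\<Sum>i<N. (cmod ((\<Phi> z (int i) *v x) $ 1))\<^sup>2)"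
proof (induction N)
  case (Suc N)
  have N: "int (Suc N) = int N + 1" by simp
  show ?case
    unfolding N using Suc by (simp add: flux_step distrib_left)
qed simp

text \<open>A solution cut off to \<open>n \<ge> 1\<close> solves the eigenvalue equation except at the two sites \<open>0\<close> and \<open>1\<close>
  next to the cut.  For the initial vector \<open>(m, 1)\<close> the defect at \<open>1\<close> is the right-hand side
  \<open>\<delta>\<^sub>1\<close> of the resolvent equation.\<close>

definition half_line_sol :: "complex \<Rightarrow> complex^2 \<Rightarrow> int \<Rightarrow> complex" where
  "half_line_sol z x n = (if n \<ge> 1 then (\<Phi> z (n - 1) *v x) $ 1 else 0)"

lemma jacobi_half_line_sol:
  "jacobi a b (half_line_sol z x) n
    = z * half_line_sol z x n + x $ 2 * delta 1 n + of_real (a 0) * x $ 1 * delta 0 n"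
proof -
  define w where "w n = (\<Phi> z (n - 1) *v x) $ 1" for n
  note sol = solution_of_fund[of w z x, OF w_def]
  have w: "of_real (a (n - 1)) * w (n - 1) + of_real (b n) * w n + of_real (a n) * w (n + 1) = z * w n" for n
    using fun_cong[OF sol(1), of n] by (simp add: jacobi_def)
  have "(vector [w 1, - of_real (a 0) * w 0] :: complex^2) = x"
    using sol(2)[of 0] by simp
  then have w0: "- of_real (a 0) * w 0 = x $ 2" and w1: "w 1 = x $ 1"
    by (metis vector_2)+
  have h: "half_line_sol z x m = (if m \<ge> 1 then w m else 0)" for m
    by (simp add: half_line_sol_def w_def)
  consider "n \<ge> 2" | "n = 1" | "n = 0" | "n < 0" by linarith
  then show ?thesis
  proof cases
    case 2
    have "of_real (a 0) * w 0 + of_real (b 1) * w 1 + of_real (a 1) * w 2 = z * w 1"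
      using w[of 1] by simp
    then have "of_real (b 1) * w 1 + of_real (a 1) * w 2 = z * w 1 + x $ 2"
      using w0 by algebra
    then show ?thesis using 2 by (simp add: jacobi_def h delta_def)
  qed (use w[of n] w1 in \<open>auto simp: jacobi_def h delta_def\<close>)
qed

lemma half_line_sol_J_op:
  assumes "half_line_sol z x \<in> ell2"
  shows "(half_line_sol z x, jacobi a b (half_line_sol z x)) \<in> J_op a b"
proof -
  have "jacobi a b (half_line_sol z x)
     = (\<lambda>n. (of_real (a 0) * x $ 1) * delta 0 n + (x $ 2 * delta 1 n + (z * half_line_sol z x n + 0)))"
    by (simp add: jacobi_half_line_sol fun_eq_iff algebra_simps)
  moreover have "(\<lambda>n. 0 :: complex) \<in> ell2" by (simp add: ell2_def)
  ultimately have "jacobi a b (half_line_sol z x) \<in> ell2"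
    using assms by (simp only: ell2_comb delta_ell2)
  with assms show ?thesis by (auto simp: J_op_def)
qed

end

locale limit_point_jacobi = jacobi_coeffs +
  assumes limit_point: "limit_point_both a b"
begin

lemma J_op_symmetric:
  assumes "(u, f) \<in> J_op a b" "(v, g) \<in> J_op a b"
  shows "ell2_inner v f = ell2_inner g u"
proof -
  have "(v, g) \<in> op_adjoint (J_op a b)"
    using limit_point assms(2) by (simp add: limit_point_both_def self_adjoint_def)
  with assms(1) show ?thesis by (auto simp: op_adjoint_def)
qed

text \<open>If the lengths were bounded, all solutions at \<open>\<xi>\<close> would be square summable at \<open>+\<infinity>\<close>.  Cutting off
  the two fundamental solutions would then give two vectors in the domain of \<open>J\<close> on which
  symmetry fails, by the value of their Wronskian.\<close>

lemma len_at_top: "filterlim (\<lambda>N. len \<xi> (int N)) at_top sequentially"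
proof (rule ccontr)
  assume not: "\<not> filterlim (\<lambda>N. len \<xi> (int N)) at_top sequentially"
  have "\<exists>C. \<forall>N. len \<xi> (int N) \<le> C"
  proof (rule ccontr)
    assume nb: "\<nexists>C. \<forall>N. len \<xi> (int N) \<le> C"
    have "filterlim (\<lambda>N. len \<xi> (int N)) at_top sequentially"
      unfolding filterlim_at_top
    proof
      fix C
      obtain N where "len \<xi> (int N) > C" using nb by (meson not_le)
      then have "\<forall>M\<ge>N. C \<le> len \<xi> (int M)"
        using len_mono by (smt (verit) of_nat_le_iff)
      then show "\<forall>\<^sub>F M in sequentially. C \<le> len \<xi> (int M)"
        by (auto simp: eventually_sequentially)
    qed
    with not show False by simp
  qed
  then obtain C where C: "len \<xi> (int N) \<le> C" for N by blast
  have len_sum: "len \<xi> (int N) = (\<Sum>i<N. (cmod (\<Phi> \<xi> (int i) $ 1 $ 1))\<^sup>2 + (cmod (\<Phi> \<xi> (int i) $ 1 $ 2))\<^sup>2)" for N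
  proof (induction N)
    case (Suc N)
    have N: "int (Suc N) = int N + 1" by simp
    show ?case unfolding N using Suc by (simp add: len_step)
  qed simp
  define u where "u = half_line_sol \<xi> (vector [1, 0])"
  define v where "v = half_line_sol \<xi> (vector [0, 1])"
  have u: "u \<in> ell2"
  proof (rule ell2_half_line[of _ C])
    fix N
    have "(\<Sum>i<N. (cmod (u (int i + 1)))\<^sup>2) \<le> len \<xi> (int N)"
      unfolding len_sum by (intro sum_mono) (simp add: u_def half_line_sol_def mat_vec_nth2)
    then show "(\<Sum>i<N. (cmod (u (int i + 1)))\<^sup>2) \<le> C" using C[of N] by simp
  qed (simp add: u_def half_line_sol_def)
  have v: "v \<in> ell2"
  proof (rule ell2_half_line[of _ C])
    fix N
    have "(\<Sum>i<N. (cmod (v (int i + 1)))\<^sup>2) \<le> len \<xi> (int N)"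
      unfolding len_sum by (intro sum_mono) (simp add: v_def half_line_sol_def mat_vec_nth2)
    then show "(\<Sum>i<N. (cmod (v (int i + 1)))\<^sup>2) \<le> C" using C[of N] by simp
  qed (simp add: v_def half_line_sol_def)
  have "ell2_inner v (jacobi a b u) = ell2_inner (jacobi a b v) u"
    using half_line_sol_J_op u v unfolding u_def v_def by (intro J_op_symmetric) auto
  moreover have "ell2_inner v (jacobi a b u) = (\<Sum>\<^sub>\<infinity>n. of_real \<xi> * (cnj (v n) * u n))"
    unfolding ell2_inner_def
    by (intro infsum_cong)
       (auto simp: u_def v_def jacobi_half_line_sol delta_def half_line_sol_def)
  moreover have "ell2_inner (jacobi a b v) u = (\<Sum>\<^sub>\<infinity>n. of_real \<xi> * (cnj (v n) * u n) + (if n = 1 then 1 else 0))"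
    unfolding ell2_inner_def
    by (intro infsum_cong)
       (auto simp: u_def v_def jacobi_half_line_sol delta_def half_line_sol_def mat_vec_nth2)
  moreover have "(\<lambda>n. of_real \<xi> * (cnj (v n) * u n)) summable_on UNIV"
    by (intro summable_on_cmult_right ell2_cnj_mult_summable u v)
  then have "(\<Sum>\<^sub>\<infinity>n. of_real \<xi> * (cnj (v n) * u n) + (if n = 1 then 1 else 0))
    = (\<Sum>\<^sub>\<infinity>n. of_real \<xi> * (cnj (v n) * u n)) + (\<Sum>\<^sub>\<infinity>n::int. (if n = 1 then 1 else 0))"
    using has_sum_single[of 1 1] by (intro infsum_add) (auto simp: summable_on_def)
  ultimately show False
    using infsumI[OF has_sum_single[of "1 :: int" 1]] by simp
qed

text \<open>A square summable solution with initial vector \<open>(m, 1)\<close> solves the resolvent equation.  It is the only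
  solution: the difference \<open>d\<close> of two of them vanishes for \<open>n < 1\<close> and satisfies \<open>(J d) n = z d n\<close>
  for \<open>n \<ge> 1\<close>, so \<open>\<langle>d, J d\<rangle> = z \<parallel>d\<parallel>\<^sup>2\<close>; symmetry of \<open>J\<close> makes this real, whence \<open>d = 0\<close>.\<close>

lemma m_plus_eqI:
  assumes z: "Im z > 0"
    and bd: "\<And>N. Im z * (\<Sum>i<N. (cmod ((\<Phi> z (int i) *v vector [m, 1]) $ 1))\<^sup>2) \<le> C"
  shows "m_plus a b z = m"
proof -
  define u where "u = half_line_sol z (vector [m, 1])"
  have u0: "u n = 0" if "n < 1" for n using that by (simp add: u_def half_line_sol_def)
  have u: "u \<in> ell2"
  proof (rule ell2_half_line[of _ "C / Im z"])
    fix N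
    have "(\<Sum>i<N. (cmod (u (int i + 1)))\<^sup>2) = (\<Sum>i<N. (cmod ((\<Phi> z (int i) *v vector [m, 1]) $ 1))\<^sup>2)"
      by (intro sum.cong) (simp_all add: u_def half_line_sol_def)
    then show "(\<Sum>i<N. (cmod (u (int i + 1)))\<^sup>2) \<le> C / Im z"
      using bd[of N] z by (simp add: field_simps)
  qed (rule u0)
  have mem: "(u, \<lambda>n. delta 1 n + z * u n) \<in> J_plus a b"
  proof -
    have "(\<lambda>n. delta 1 n + z * u n) = (\<lambda>n. if n \<ge> 1 then jacobi a b u n else 0)"
      by (auto simp: u_def jacobi_half_line_sol delta_def half_line_sol_def fun_eq_iff)
    moreover have "(u, jacobi a b u) \<in> J_op a b"
      using half_line_sol_J_op u by (simp add: u_def)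
    ultimately show ?thesis
      unfolding J_plus_def using u0 by blast
  qed
  have "resolvent (J_plus a b) z (delta 1) = u"
    unfolding resolvent_def
  proof (rule the_equality)
    show "(u, \<lambda>n. delta 1 n + z * u n) \<in> J_plus a b" by (rule mem)
    fix v assume "(v, \<lambda>n. delta 1 n + z * v n) \<in> J_plus a b"
    then obtain f where f: "(v, f) \<in> J_op a b" "\<And>n. n < 1 \<Longrightarrow> v n = 0"
      and fe: "(\<lambda>n. delta 1 n + z * v n) = (\<lambda>n. if n \<ge> 1 then f n else 0)"
      by (auto simp: J_plus_def)
    from f(1) have v: "v \<in> ell2" "jacobi a b v \<in> ell2" "f = jacobi a b v" by (auto simp: J_op_def)
    define d where "d n = (-1) * u n + v n" for n
    have d0: "d n = 0" if "n < 1" for n using that u0 f(2) by (simp add: d_def)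
    have Jd: "jacobi a b d n = (-1) * jacobi a b u n + jacobi a b v n" for n
      by (simp add: d_def jacobi_def algebra_simps)
    have Jd1: "jacobi a b d n = z * d n" if "n \<ge> 1" for n
      using fun_cong[OF fe, of n] that v(3)
      by (simp add: Jd d_def u_def jacobi_half_line_sol delta_def algebra_simps)
    have d: "d \<in> ell2" unfolding d_def by (rule ell2_comb[OF u v(1)])
    have "jacobi a b u \<in> ell2" using half_line_sol_J_op u by (auto simp: u_def J_op_def)
    then have "jacobi a b d \<in> ell2" unfolding Jd using ell2_comb v(2) by blast
    with d have dJ: "(d, jacobi a b d) \<in> J_op a b" by (auto simp: J_op_def)
    have 1: "ell2_inner d (jacobi a b d) = (\<Sum>\<^sub>\<infinity>n. z * of_real ((cmod (d n))\<^sup>2))"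
      unfolding ell2_inner_def
    proof (rule infsum_cong)
      fix n show "cnj (d n) * jacobi a b d n = z * of_real ((cmod (d n))\<^sup>2)"
        by (cases "n \<ge> 1") (simp_all add: d0 Jd1 complex_norm_square mult.commute flip: of_real_power)
    qed
    have 2: "ell2_inner (jacobi a b d) d = (\<Sum>\<^sub>\<infinity>n. cnj z * of_real ((cmod (d n))\<^sup>2))"
      unfolding ell2_inner_def
    proof (rule infsum_cong)
      fix n show "cnj (jacobi a b d n) * d n = cnj z * of_real ((cmod (d n))\<^sup>2)"
        by (cases "n \<ge> 1") (simp_all add: d0 Jd1 complex_norm_square mult.commute flip: of_real_power)
    qed
    have s: "(\<lambda>n. (cmod (d n))\<^sup>2) summable_on UNIV" using d by (simp add: ell2_def)
    have "(z - cnj z) * (\<Sum>\<^sub>\<infinity>n. of_real ((cmod (d n))\<^sup>2)) = 0"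
      using J_op_symmetric[OF dJ dJ] unfolding 1 2 by (simp add: infsum_cmult_right' algebra_simps)
    moreover have "z - cnj z \<noteq> 0" using z by (auto simp: complex_eq_iff)
    moreover have "(\<Sum>\<^sub>\<infinity>n. of_real ((cmod (d n))\<^sup>2)) = (of_real (\<Sum>\<^sub>\<infinity>n. (cmod (d n))\<^sup>2) :: complex)"
      by (rule infsumI[OF has_sum_of_real[OF has_sum_infsum[OF s]]])
    ultimately have "of_real (\<Sum>\<^sub>\<infinity>n. (cmod (d n))\<^sup>2) = (0 :: complex)"
      by (simp only: mult_eq_0_iff) simp
    then have "(\<Sum>\<^sub>\<infinity>n. (cmod (d n))\<^sup>2) = 0" by simp
    then have "(cmod (d n))\<^sup>2 = 0" for n
      using nonneg_infsum_le_0D[OF _ s] by (metis UNIV_I order_refl zero_le_power2)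
    then show "v = u" by (simp add: d_def fun_eq_iff)
  qed
  then show ?thesis
    by (simp add: m_plus_def ell2_inner_delta u_def half_line_sol_def mat_vec_nth2)
qed

lemma fund_11_nonzero:
  assumes "Im z > 0"
  shows "\<Phi> z (int (Suc N)) $ 1 $ 1 \<noteq> 0"
proof
  assume *: "\<Phi> z (int (Suc N)) $ 1 $ 1 = 0"
  let ?s = "\<lambda>i. (cmod ((\<Phi> z (int i) *v vector [1, 0]) $ 1))\<^sup>2"
  have "Im z * (\<Sum>i<Suc N. ?s i) = 0"
    using flux_sum[of z "Suc N" "vector [1, 0]"] * by (simp add: flux_def mat_vec_nth2)
  moreover have "?s 0 \<le> (\<Sum>i<Suc N. ?s i)" by (rule member_le_sum) auto
  ultimately show False using assms by (simp add: mat_vec_nth2)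
qed

text \<open>The Weyl function is a limit, along a subsequence, of the rational functions \<open>mN N\<close> obtained by
  imposing a Dirichlet condition at a far site: these are bounded by \<open>1 / Im z\<close> because their flux vanishes at
  that site.  Green's identity carries over to the limit, which shows both that the limit is
  \<open>m_plus\<close> and that the flux of the Weyl solution never becomes negative.\<close>

proposition m_plus_weyl:
  shows m_plus_holomorphic: "m_plus a b holomorphic_on {z. Im z > 0}"
    and m_plus_flux: "\<And>z n. Im z > 0 \<Longrightarrow>
      flux ((\<Phi> z (int n) *v vector [m_plus a b z, 1]) $ 1) ((\<Phi> z (int n) *v vector [m_plus a b z, 1]) $ 2) \<ge> 0"
proof -
  let ?U = "{z. Im z > 0}"
  define mN where "mN N z = - \<Phi> z (int (Suc N)) $ 1 $ 2 / \<Phi> z (int (Suc N)) $ 1 $ 1" for N z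
  define S where "S z m n = (\<Sum>i<n. (cmod ((\<Phi> z (int i) *v vector [m, 1]) $ 1))\<^sup>2)" for z m n
  have opn: "open ?U" by (simp add: open_halfspace_Im_gt)
  have hol: "mN N holomorphic_on ?U" for N
    unfolding mN_def by (intro holomorphic_intros fund_holomorphic) (simp add: fund_11_nonzero del: of_nat_Suc)
  \<comment> \<open>The flux at the site \<open>Suc N\<close> vanishes, so Green's identity determines the flux at \<open>0\<close>, which is \<open>Im m\<close>.\<close>
  have en: "Im (mN N z) = Im z * S z (mN N z) (Suc N)" if "z \<in> ?U" for N z
  proof -
    have "(\<Phi> z (int (Suc N)) *v vector [mN N z, 1]) $ 1 = 0"
      using fund_11_nonzero[of z N] that by (simp add: mat_vec_nth2 mN_def del: of_nat_Suc)
    then show ?thesis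
      using flux_sum[of z "Suc N" "vector [mN N z, 1]"] by (simp add: flux_def S_def del: of_nat_Suc)
  qed
  have S_mono: "S z m n \<le> S z m n'" if "n \<le> n'" for z m n n'
    unfolding S_def using that by (intro sum_mono2) auto
  have bound: "cmod (mN N z) \<le> 1 / Im z" if "z \<in> ?U" for N z
  proof -
    have "S z (mN N z) 1 \<le> S z (mN N z) (Suc N)" by (rule S_mono) simp
    then have "Im z * (cmod (mN N z))\<^sup>2 \<le> Im (mN N z)"
      using that en[OF that, of N] by (simp add: S_def mat_vec_nth2)
    also have "\<dots> \<le> cmod (mN N z)" by (rule order_trans[OF abs_ge_self abs_Im_le_cmod])
    finally have *: "(Im z * cmod (mN N z)) * cmod (mN N z) \<le> 1 * cmod (mN N z)"
      by (simp add: power2_eq_square mult.assoc)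
    show ?thesis
    proof (cases "mN N z = 0")
      case False
      then have "Im z * cmod (mN N z) \<le> 1" using * by (subst (asm) mult_le_cancel_right) auto
      then show ?thesis using that by (simp add: field_simps)
    qed (use that in auto)
  qed
  obtain g r where g: "g holomorphic_on ?U" and r: "strict_mono (r :: nat \<Rightarrow> nat)"
    and lim: "\<And>z. z \<in> ?U \<Longrightarrow> (\<lambda>N. mN (r N) z) \<longlonglongrightarrow> g z"
  proof (rule Montel[of ?U "range mN" mN])
    show "\<exists>B. \<forall>h\<in>range mN. \<forall>z\<in>K. cmod (h z) \<le> B" if K: "compact K" "K \<subseteq> ?U" for K
    proof (cases "K = {}")
      case False
      have "continuous_on K Im" by (intro continuous_intros)
      then obtain w where w: "w \<in> K" "\<And>z. z \<in> K \<Longrightarrow> Im w \<le> Im z"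
        using continuous_attains_inf[OF K(1) False, of Im] by blast
      have "cmod (mN N z) \<le> 1 / Im w" if "z \<in> K" for N z
      proof -
        have "cmod (mN N z) \<le> 1 / Im z" using bound that K by blast
        also have "\<dots> \<le> 1 / Im w"
        proof (rule divide_left_mono)
          have "0 < Im z" "0 < Im w" using w(1) that K by auto
          then show "0 < Im z * Im w" by simp
        qed (use w(2)[OF that] in auto)
        finally show ?thesis .
      qed
      then show ?thesis by auto
    qed auto
  qed (use opn hol in auto)
  have vec_lim: "(\<lambda>N. (\<Phi> z n *v vector [mN (r N) z, 1]) $ i) \<longlonglongrightarrow> (\<Phi> z n *v vector [g z, 1]) $ i"
    if "z \<in> ?U" for z n i
    unfolding mat_vec_nth2 using lim[OF that] by (auto intro!: tendsto_intros)
  have fl: "Im z * S z (g z) n \<le> Im (g z)" if "z \<in> ?U" for z n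
  proof (rule tendsto_le[OF sequentially_bot])
    show "(\<lambda>N. Im z * S z (mN (r N) z) n) \<longlonglongrightarrow> Im z * S z (g z) n"
      unfolding S_def by (intro tendsto_intros vec_lim that)
    show "(\<lambda>N. Im (mN (r N) z)) \<longlonglongrightarrow> Im (g z)"
      by (intro tendsto_intros lim that)
    have "Im z * S z (mN (r N) z) n \<le> Im (mN (r N) z)" if "N \<ge> n" for N
    proof -
      have "n \<le> Suc (r N)" using that seq_suble[OF r, of N] by simp
      then show ?thesis using en[OF \<open>z \<in> ?U\<close>, of "r N"] S_mono \<open>z \<in> ?U\<close> by simp
    qed
    then show "\<forall>\<^sub>F N in sequentially. Im z * S z (mN (r N) z) n \<le> Im (mN (r N) z)"
      by (auto simp: eventually_sequentially)
  qed
  have eq: "m_plus a b z = g z" if "z \<in> ?U" for z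
    using that fl[OF that] by (intro m_plus_eqI[of z "g z" "Im (g z)"]) (auto simp: S_def)
  show "m_plus a b holomorphic_on ?U"
    using g eq by (metis holomorphic_transform)
  show "flux ((\<Phi> z (int n) *v vector [m_plus a b z, 1]) $ 1) ((\<Phi> z (int n) *v vector [m_plus a b z, 1]) $ 2) \<ge> 0"
    if "Im z > 0" for z n
    using that fl[of z n] flux_sum[of z n "vector [m_plus a b z, 1]"] by (simp add: flux_def S_def eq)
qed

end

section \<open>Normal families and entire functions\<close>

lemma tendsto_subsequence_principle:
  fixes X :: "nat \<Rightarrow> 'a::topological_space"
  assumes "\<And>r :: nat \<Rightarrow> nat. strict_mono r \<Longrightarrow> \<exists>r' :: nat \<Rightarrow> nat. strict_mono r' \<and> (\<lambda>n. X (r (r' n))) \<longlonglongrightarrow> L"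
  shows "X \<longlonglongrightarrow> L"
proof (rule ccontr)
  assume "\<not> X \<longlonglongrightarrow> L"
  then obtain S where S: "open S" "L \<in> S" "\<not> (\<forall>\<^sub>F n in sequentially. X n \<in> S)"
    unfolding tendsto_def by blast
  obtain r :: "nat \<Rightarrow> nat" where r: "strict_mono r" "\<And>n. X (r n) \<notin> S"
    using not_eventually_sequentiallyD[OF S(3)] by blast
  obtain r' :: "nat \<Rightarrow> nat" where "(\<lambda>n. X (r (r' n))) \<longlonglongrightarrow> L" using assms[OF r(1)] by blast
  then have "\<forall>\<^sub>F n in sequentially. X (r (r' n)) \<in> S" using S(1,2) by (rule topological_tendstoD)
  then show False using r(2) by simp
qed

lemma holomorphic_on_composed:
  assumes "g holomorphic_on T" "f holomorphic_on S" "\<And>x. x \<in> S \<Longrightarrow> f x \<in> T"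
  shows "(\<lambda>x. g (f x)) holomorphic_on S"
  using holomorphic_on_compose_gen[OF assms(2,1)] assms(3) by (auto simp: o_def)

text \<open>A form of Vitali's theorem: along any subsequence on which uniform convergence fails, Montel's
  theorem would provide a further subsequence converging uniformly, necessarily to the pointwise limit.\<close>

lemma vitali_uniform:
  assumes S: "open S" and hol: "\<And>n. f n holomorphic_on S"
    and bd: "\<And>K. compact K \<Longrightarrow> K \<subseteq> S \<Longrightarrow> \<exists>B. \<forall>n. \<forall>z\<in>K. cmod (f n z) \<le> B"
    and lim: "\<And>z. z \<in> S \<Longrightarrow> (\<lambda>n. f n z) \<longlonglongrightarrow> g z"
    and K: "compact K" "K \<subseteq> S"
  shows "uniform_limit K f g sequentially"
proof (rule ccontr)
  assume "\<not> uniform_limit K f g sequentially"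
  then obtain e where e: "e > 0" "\<not> (\<forall>\<^sub>F n in sequentially. \<forall>z\<in>K. dist (f n z) (g z) < e)"
    by (auto simp: uniform_limit_iff)
  obtain r :: "nat \<Rightarrow> nat" where r: "strict_mono r" "\<And>n. \<not> (\<forall>z\<in>K. dist (f (r n) z) (g z) < e)"
    using not_eventually_sequentiallyD[OF e(2)] by blast
  have bd': "\<exists>B. \<forall>h\<in>range (\<lambda>n. f (r n)). \<forall>z\<in>K. cmod (h z) \<le> B" if "compact K" "K \<subseteq> S" for K
    using bd[OF that] by blast
  obtain h r' where h: "strict_mono r'" "\<And>z. z \<in> S \<Longrightarrow> (\<lambda>n. f (r (r' n)) z) \<longlonglongrightarrow> h z"
    "\<And>K. compact K \<Longrightarrow> K \<subseteq> S \<Longrightarrow> uniform_limit K ((\<lambda>n. f (r n)) \<circ> r') h sequentially"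
    by (rule Montel[OF S _ bd', of "\<lambda>n. f (r n)"]) (use hol in auto)
  have "h z = g z" if "z \<in> S" for z
    using LIMSEQ_unique[OF h(2)[OF that]]
      LIMSEQ_subseq_LIMSEQ[OF lim[OF that] strict_mono_o[OF r(1) h(1)]] by (simp add: o_def)
  then have "\<forall>\<^sub>F n in sequentially. \<forall>z\<in>K. dist (f (r (r' n)) z) (g z) < e"
    using h(3)[OF K] e(1) K(2) unfolding uniform_limit_iff by (auto simp: subset_iff)
  then show False using r(2) by (auto simp: eventually_sequentially)
qed

lemma deriv_tendsto_of_uniform_limit:
  assumes hol: "\<And>n. f n holomorphic_on UNIV"
    and ulim: "\<And>K. compact K \<Longrightarrow> uniform_limit K f g sequentially"
  shows "(\<lambda>n. deriv (f n) z) \<longlonglongrightarrow> deriv g z"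
proof -
  obtain g' where "\<forall>x\<in>UNIV. (g has_field_derivative g' x) (at x) \<and> (\<lambda>n. deriv (f n) x) \<longlonglongrightarrow> g' x"
    using has_complex_derivative_uniform_sequence[of UNIV f "\<lambda>n. deriv (f n)" g]
      holomorphic_derivI[OF hol open_UNIV] ulim[OF compact_cball] zero_less_one by blast
  then show ?thesis by (metis DERIV_imp_deriv UNIV_I)
qed

text \<open>The case of Hadamard's factorisation theorem without zeros.  The logarithm \<open>g\<close> has linearly bounded
  real part; by the argument of Borel and Caratheodory, that is, the Schwarz lemma for
  \<open>g / (2 A - g)\<close>, so has \<open>g\<close> itself, which is therefore linear.\<close>

lemma entire_exponential_type_nonzero:
  assumes hol: "f holomorphic_on UNIV" and nz: "\<And>z. f z \<noteq> 0" and f0: "f 0 = 1"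
    and bd: "\<And>z. cmod (f z) \<le> C * exp (c * cmod z)" and c: "c \<ge> 0"
  obtains \<kappa> where "\<And>z. f z = exp (\<kappa> * z)"
proof -
  obtain g0 where g0: "g0 holomorphic_on UNIV" "\<And>z. exp (g0 z) = f z"
    using holomorphic_logarithm_exists[of UNIV f 0] hol nz by auto
  define g where "g z = g0 z - g0 0" for z
  have g: "g holomorphic_on UNIV" unfolding g_def by (intro holomorphic_intros g0)
  have eg: "exp (g z) = f z" for z
    using g0(2)[of z] g0(2)[of 0] f0 by (simp add: g_def exp_diff)
  have C: "C \<ge> 1" using bd[of 0] f0 by simp
  have Re_g: "Re (g z) \<le> ln C + c * cmod z" for z
  proof -
    have "exp (Re (g z)) = cmod (f z)" by (simp flip: eg)
    also have "\<dots> \<le> exp (ln C + c * cmod z)" using bd[of z] C by (simp add: exp_add)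
    finally show ?thesis by simp
  qed
  have bound: "cmod (g z) \<le> 2 * (ln C + 1 + 2 * c * cmod z)" if z: "z \<noteq> 0" for z
  proof -
    \<comment> \<open>On the disc of radius \<open>R\<close> the real part of \<open>g\<close> is below \<open>A\<close>, so \<open>\<phi>\<close> maps the unit disc into itself.\<close>
    define A where "A = ln C + 1 + 2 * c * cmod z"
    define R where "R = 2 * cmod z"
    have R: "R > 0" using z by (simp add: R_def)
    have A: "A > 0" using C c by (simp add: A_def add_nonneg_pos add_pos_nonneg)
    define \<phi> where "\<phi> x = g (of_real R * x) / (of_real (2 * A) - g (of_real R * x))" for x :: complex
    have ReA: "Re (g (of_real R * x)) < A" if "cmod x < 1" for x
    proof -
      have "c * cmod (of_real R * x) \<le> c * R"
        using that R c by (intro mult_left_mono) (simp_all add: norm_mult)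
      then show ?thesis using Re_g[of "of_real R * x"] by (simp add: A_def R_def)
    qed
    have den: "of_real (2 * A) - g (of_real R * x) \<noteq> 0" if "cmod x < 1" for x
    proof
      assume "of_real (2 * A) - g (of_real R * x) = 0"
      then have "Re (g (of_real R * x)) = 2 * A" by (simp add: complex_eq_iff)
      then show False using ReA[OF that] A by simp
    qed
    have "cmod (\<phi> (z / of_real R)) \<le> cmod (z / of_real R)"
    proof (rule Schwarz_Lemma(1))
      show "\<phi> holomorphic_on ball 0 1"
        unfolding \<phi>_def using den
        by (intro holomorphic_intros holomorphic_on_composed[OF g]) auto
      show "\<phi> 0 = 0" by (simp add: \<phi>_def g_def)
      show "cmod (z / of_real R) < 1" using z by (simp add: R_def norm_divide)
      fix x :: complex assume x: "cmod x < 1"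
      let ?w = "g (of_real R * x)"
      have "(cmod ?w)\<^sup>2 < (cmod (of_real (2 * A) - ?w))\<^sup>2"
      proof -
        have "(cmod (of_real (2 * A) - ?w))\<^sup>2 - (cmod ?w)\<^sup>2 = 4 * A * (A - Re ?w)"
          by (simp only: cmod_power2) (simp add: power2_eq_square algebra_simps)
        moreover have "4 * A * (A - Re ?w) > 0" using A ReA[OF x] by simp
        ultimately show ?thesis by linarith
      qed
      then have "cmod ?w < cmod (of_real (2 * A) - ?w)" by (rule power_less_imp_less_base) simp
      then show "cmod (\<phi> x) < 1" using den[OF x] by (simp add: \<phi>_def norm_divide divide_less_eq)
    qed
    moreover have half: "cmod (z / of_real R) = 1 / 2" using z by (simp add: R_def norm_divide)
    moreover have cancel: "of_real R * (z / of_real R) = z" using R by simp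
    moreover have "of_real (2 * A) - g z \<noteq> 0" using den[of "z / of_real R"] half cancel by simp
    ultimately have "cmod (g z) \<le> cmod (of_real (2 * A) - g z) / 2"
      unfolding \<phi>_def cancel norm_divide[of "g z"] half by (simp add: divide_le_eq)
    also have "\<dots> \<le> (2 * A + cmod (g z)) / 2"
      using norm_triangle_ineq4[of "of_real (2 * A)" "g z"] A by simp
    finally show ?thesis by (simp add: A_def)
  qed
  have "g z = (\<Sum>k\<le>1. (deriv^^k) g 0 / fact k * z ^ k)" for z
  proof (rule Liouville_polynomial[OF g])
    fix z :: complex assume z: "1 \<le> cmod z"
    have "cmod (g z) \<le> 2 * (ln C + 1 + 2 * c * cmod z)" using z by (intro bound) auto
    also have "\<dots> \<le> 2 * ((ln C + 1) * cmod z + 2 * c * cmod z)"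
      using z C mult_left_mono[of 1 "cmod z" "ln C + 1"] by simp
    finally show "cmod (g z) \<le> (2 * (ln C + 1 + 2 * c)) * cmod z ^ 1" by (simp add: algebra_simps)
  qed
  then have "g z = deriv g 0 * z" for z by (simp add: g_def)
  then have "f z = exp (deriv g 0 * z)" for z by (metis eg)
  then show ?thesis by (rule that)
qed

lemma Im_divide_flux: "Im (x / y) = flux x y / (cmod y)\<^sup>2"
  by (simp add: flux_def Im_divide cmod_power2 algebra_simps)

lemma flux_swap: "flux y x = - flux x y"
  by (simp add: flux_def algebra_simps)

text \<open>Nonnegative flux forbids zeros of \<open>f2\<close>: near a zero above the real axis the quotient \<open>f2 / f1\<close>
  takes values in the closed lower half-plane and attains the boundary value \<open>0\<close>, so by the open mapping
  theorem it would vanish identically, against \<open>f2 0 = 1\<close>.  Hence \<open>f1 / f2\<close> is entire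
  with nonnegative imaginary part, so constant by Liouville's theorem.\<close>

proposition positive_flux_rigidity:
  assumes hol: "f1 holomorphic_on UNIV" "f2 holomorphic_on UNIV"
    and at0: "f1 0 = \<eta>" "f2 0 = 1"
    and bd: "\<And>z. cmod (f2 z) \<le> C * exp (c * cmod z)" "c \<ge> 0"
    and lower: "\<And>z. Im z \<le> 0 \<Longrightarrow> flux (f1 z) (f2 z) > 0"
    and upper: "\<And>z. Im z > 0 \<Longrightarrow> flux (f1 z) (f2 z) \<ge> 0"
    and nocommon: "\<And>z. f1 z \<noteq> 0 \<or> f2 z \<noteq> 0"
  obtains \<kappa> where "\<And>z. f1 z = \<eta> * exp (\<kappa> * z)" "\<And>z. f2 z = exp (\<kappa> * z)"
proof -
  have fl: "flux (f1 z) (f2 z) \<ge> 0" for z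
    using lower[of z] upper[of z] by (cases "Im z > 0") auto
  have nz: "f2 z \<noteq> 0" for z
  proof (cases "Im z > 0")
    case False
    then show ?thesis using lower[of z] by (auto simp: flux_def)
  next
    case True
    show ?thesis
    proof
      assume z0: "f2 z = 0"
      then have "f1 z \<noteq> 0" using nocommon by blast
      moreover have "isCont f1 z"
        using hol(1) by (metis UNIV_I continuous_on_eq_continuous_at holomorphic_on_imp_continuous_on open_UNIV)
      ultimately obtain e where e: "e > 0" "\<And>x. x \<in> ball z e \<Longrightarrow> f1 x \<noteq> 0"
        using continuous_at_avoid[of z f1 0] by (auto simp: dist_commute)
      define h where "h x = f2 x / f1 x" for x
      have h: "h holomorphic_on ball z e"
        unfolding h_def using e(2) by (intro holomorphic_intros holomorphic_on_subset[OF hol(1)]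
            holomorphic_on_subset[OF hol(2)]) auto
      have Imh: "Im (h x) \<le> 0" for x
        using fl[of x] by (simp add: h_def Im_divide_flux flux_swap[of "f2 x"])
      have "h constant_on ball z e"
      proof (rule ccontr)
        assume "\<not> h constant_on ball z e"
        then have "open (h ` ball z e)"
          by (intro open_mapping_thm[OF h open_ball]) auto
        moreover have "h z \<in> h ` ball z e" using e(1) by simp
        moreover have "h z = 0" using z0 by (simp add: h_def)
        ultimately obtain d where d: "d > 0" "ball 0 d \<subseteq> h ` ball z e"
          by (metis open_contains_ball)
        have "\<i> * of_real (d / 2) \<in> ball 0 d" using d(1) by (simp add: norm_mult)
        then have "\<i> * of_real (d / 2) \<in> h ` ball z e" using d(2) by blast
        then obtain x where "h x = \<i> * of_real (d / 2)" by (metis imageE)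
        then have "Im (h x) = Im (\<i> * of_real (d / 2))" by (rule arg_cong)
        then have "Im (h x) = d / 2" by simp
        then show False using Imh[of x] d(1) by simp
      qed
      then have "h x = h z" if "x \<in> ball z e" for x
        using that e(1) unfolding constant_on_def by (metis centre_in_ball)
      then have f2z: "f2 x = 0" if "x \<in> ball z e" for x
        using that z0 e(2) by (force simp: h_def)
      have "f2 0 = 0"
        by (rule analytic_continuation[OF hol(2), of "ball z e" z])
           (use e f2z in \<open>auto simp: islimpt_ball\<close>)
      then show False using at0 by simp
    qed
  qed
  have "(\<lambda>z. 1 / (f1 z / f2 z + \<i>)) constant_on UNIV"
  proof (rule Liouville_theorem)
    have Im: "Im (f1 z / f2 z + \<i>) \<ge> 1" for z
      using fl[of z] by (simp only: plus_complex.sel Im_divide_flux) simp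
    then have ne: "f1 z / f2 z + \<i> \<noteq> 0" for z
      by (metis zero_complex.sel(2) not_one_le_zero)
    show "(\<lambda>z. 1 / (f1 z / f2 z + \<i>)) holomorphic_on UNIV"
      using ne nz by (intro holomorphic_intros hol) auto
    have "cmod (1 / (f1 z / f2 z + \<i>)) \<le> 1" for z
    proof -
      have "1 \<le> cmod (f1 z / f2 z + \<i>)"
        using Im[of z] abs_Im_le_cmod[of "f1 z / f2 z + \<i>"] by linarith
      then show ?thesis by (simp add: norm_divide divide_le_eq)
    qed
    then show "bounded (range (\<lambda>z. 1 / (f1 z / f2 z + \<i>)))"
      unfolding bounded_iff by blast
  qed
  then have "1 / (f1 z / f2 z + \<i>) = 1 / (f1 0 / f2 0 + \<i>)" for z
    unfolding constant_on_def by (metis UNIV_I)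
  then have "f1 z / f2 z + \<i> = \<eta> + \<i>" for z
    using at0 by (metis div_by_1 divide_divide_eq_right mult_1 one_divide_eq_0_iff divide_cancel_left zero_neq_one)
  then have "f1 z / f2 z = \<eta>" for z by simp
  then have f1: "f1 z = \<eta> * f2 z" for z
    using nz[of z] by (metis nonzero_divide_eq_eq)
  obtain \<kappa> where "\<And>z. f2 z = exp (\<kappa> * z)"
    using entire_exponential_type_nonzero[OF hol(2) nz at0(2) bd] by blast
  with f1 show ?thesis by (intro that) auto
qed

text \<open>The Cayley transform \<open>c\<close> of \<open>m\<close>, centred at \<open>\<eta>\<close>, is bounded by one, so its dilates form a
  normal family.  Each limit function vanishes on the imaginary axis, where the dilates
  converge by assumption, and therefore everywhere.\<close>

lemma herglotz_rescaling:
  fixes m :: "complex \<Rightarrow> complex" and t :: "nat \<Rightarrow> real"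
  assumes hol: "m holomorphic_on {z. Im z > 0}" and pos: "\<And>z. Im z > 0 \<Longrightarrow> Im (m z) \<ge> 0"
    and lim: "((\<lambda>y. m (\<i> * of_real y)) \<longlongrightarrow> \<eta>) (at_right (0::real))" and eta: "Im \<eta> > 0"
    and t: "filterlim t at_top sequentially" "\<And>n. t n > 0"
    and z: "Im z > 0"
  shows "(\<lambda>n. m (z / of_real (t n))) \<longlonglongrightarrow> \<eta>"
proof -
  let ?U = "{z. Im z > 0}"
  \<comment> \<open>The Cayley transform maps the upper half-plane to the unit disc and \<open>\<eta>\<close> to its centre.\<close>
  define c where "c w = (m w - \<eta>) / (m w - cnj \<eta>)" for w
  have den: "m w - cnj \<eta> \<noteq> 0" if "w \<in> ?U" for w
  proof
    assume "m w - cnj \<eta> = 0"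
    then have "Im (m w) = - Im \<eta>" by (simp add: complex_eq_iff)
    then show False using pos[of w] that eta by simp
  qed
  have c_hol: "c holomorphic_on ?U"
    unfolding c_def using den by (intro holomorphic_intros hol) auto
  have c_bd: "cmod (c w) \<le> 1" if "w \<in> ?U" for w
  proof -
    have "(cmod (m w - cnj \<eta>))\<^sup>2 - (cmod (m w - \<eta>))\<^sup>2 = 4 * Im (m w) * Im \<eta>"
      by (simp only: cmod_power2) (simp add: power2_eq_square algebra_simps)
    moreover have "4 * Im (m w) * Im \<eta> \<ge> 0" using pos[of w] that eta by simp
    ultimately have "(cmod (m w - \<eta>))\<^sup>2 \<le> (cmod (m w - cnj \<eta>))\<^sup>2" by linarith
    then have "cmod (m w - \<eta>) \<le> cmod (m w - cnj \<eta>)" by (rule power2_le_imp_le) simp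
    then show ?thesis using den[OF that] by (simp add: c_def norm_divide divide_le_eq)
  qed
  define f where "f n w = c (w / of_real (t n))" for n w
  have scale: "w / of_real (t n) \<in> ?U" if "w \<in> ?U" for w n
    using that t(2)[of n] by (simp add: Im_divide_of_real)
  have f_hol: "f n holomorphic_on ?U" for n
    unfolding f_def using scale t(2)[of n]
    by (intro holomorphic_on_composed[OF c_hol] holomorphic_intros) auto
  have f_bd: "cmod (f n w) \<le> 1" if "w \<in> ?U" for n w
    unfolding f_def by (intro c_bd scale that)
  have axis: "(\<lambda>n. f n (\<i> * of_real y)) \<longlonglongrightarrow> 0" if "y > 0" for y
  proof -
    have "((\<lambda>y. c (\<i> * of_real y)) \<longlongrightarrow> (\<eta> - \<eta>) / (\<eta> - cnj \<eta>)) (at_right (0::real))"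
      unfolding c_def using eta by (intro tendsto_intros lim) (auto simp: complex_eq_iff)
    moreover have "filterlim (\<lambda>n. y / t n) (at_right 0) sequentially"
      using that t less_imp_neq[OF t(2), symmetric] by (auto simp: filterlim_at intro!: tendsto_divide_0[OF tendsto_const]
          filterlim_at_top_imp_at_infinity)
    ultimately have "(\<lambda>n. c (\<i> * of_real (y / t n))) \<longlonglongrightarrow> (\<eta> - \<eta>) / (\<eta> - cnj \<eta>)"
      by (rule filterlim_compose)
    then show ?thesis by (simp add: f_def)
  qed
  have "(\<lambda>n. f n z) \<longlonglongrightarrow> 0"
  proof (rule tendsto_subsequence_principle)
    fix r :: "nat \<Rightarrow> nat" assume r: "strict_mono r"
    have opn: "open ?U" by (simp add: open_halfspace_Im_gt)
    have bd: "\<exists>B. \<forall>h\<in>range (\<lambda>n. f (r n)). \<forall>z\<in>K. cmod (h z) \<le> B" if "compact K" "K \<subseteq> ?U" for K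
      using f_bd that by blast
    obtain h r' where h: "h holomorphic_on ?U" "strict_mono r'"
      "\<And>w. w \<in> ?U \<Longrightarrow> (\<lambda>n. f (r (r' n)) w) \<longlonglongrightarrow> h w"
      by (rule Montel[OF opn _ bd, of "\<lambda>n. f (r n)"]) (use f_hol in auto)
    have zero: "h (\<i> * of_real y) = 0" if "y > 0" for y
    proof (rule LIMSEQ_unique)
      show "(\<lambda>n. f (r (r' n)) (\<i> * of_real y)) \<longlonglongrightarrow> h (\<i> * of_real y)"
        using that by (intro h) simp
      show "(\<lambda>n. f (r (r' n)) (\<i> * of_real y)) \<longlonglongrightarrow> 0"
        using LIMSEQ_subseq_LIMSEQ[OF axis[OF that] strict_mono_o[OF r h(2)]] by (simp add: o_def)
    qed
    have "h z = 0"
    proof (rule analytic_continuation[OF h(1) opn])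
      show "connected ?U" by (intro convex_connected convex_halfspace_Im_gt)
      show "(\<lambda>y. \<i> * of_real y) ` {0<..} \<subseteq> ?U" by auto
      show "\<i> \<in> ?U" by simp
      show "\<i> islimpt (\<lambda>y. \<i> * of_real y) ` {0<..}"
        unfolding islimpt_approachable
      proof (intro allI impI)
        fix e :: real assume e: "e > 0"
        have "dist (\<i> * of_real (1 + e / 2)) \<i> < e"
          using e by (simp add: dist_norm distrib_left norm_mult)
        then show "\<exists>x'\<in>(\<lambda>y. \<i> * of_real y) ` {0<..}. x' \<noteq> \<i> \<and> dist x' \<i> < e"
          using e by (intro bexI[of _ "\<i> * of_real (1 + e / 2)"]) (auto simp: complex_eq_iff intro!: image_eqI[of _ _ "1 + e / 2"])
      qed
    qed (use zero z in auto)
    then show "\<exists>r'. strict_mono r' \<and> (\<lambda>n. f (r (r' n)) z) \<longlonglongrightarrow> 0"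
      using h(2) h(3)[of z] z by auto
  qed
  then have "(\<lambda>n. (\<eta> - cnj \<eta> * f n z) / (1 - f n z)) \<longlonglongrightarrow> (\<eta> - cnj \<eta> * 0) / (1 - 0)"
    by (intro tendsto_intros) auto
  moreover have "(\<eta> - cnj \<eta> * c w) / (1 - c w) = m w" if "w \<in> ?U" for w
  proof -
    have "\<eta> - cnj \<eta> \<noteq> 0" using eta by (auto simp: complex_eq_iff)
    moreover have "1 - c w = (\<eta> - cnj \<eta>) / (m w - cnj \<eta>)"
      and "\<eta> - cnj \<eta> * c w = (\<eta> - cnj \<eta>) * m w / (m w - cnj \<eta>)"
      using den[OF that] by (simp_all add: c_def divide_simps) (simp_all add: algebra_simps)
    ultimately show ?thesis using den[OF that] by simp
  qed
  ultimately show ?thesis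
    using scale[of z] z by (simp add: f_def)
qed

section \<open>Rigidity of limits of transfer matrices\<close>

text \<open>This is \<open>exp (s G) = cos s + sin s G\<close> for \<open>Im \<eta> > 0\<close> and \<open>G = j H / h\<close>, where \<open>H\<close> is \<open>H_ring \<eta>\<close> and \<open>h\<close> the
  square root of its determinant, so that \<open>G\<^sup>2 = - 1\<close>.\<close>

definition rot :: "complex \<Rightarrow> complex \<Rightarrow> complex^2^2" where
  "rot \<eta> s = mat2 (cos s + sin s * (Re \<eta> / Im \<eta>)) (- sin s * ((cmod \<eta>)\<^sup>2 / Im \<eta>))
                 (sin s / Im \<eta>) (cos s - sin s * (Re \<eta> / Im \<eta>))"

text \<open>The matrix \<open>rot \<eta> s\<close> is determined by its eigenvectors \<open>(\<eta>, 1)\<close> and \<open>(cnj \<eta>, 1)\<close> with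
  eigenvalues \<open>exp (\<i> s)\<close> and \<open>exp (- \<i> s)\<close>.\<close>

lemma rot_from_eigenvectors:
  assumes eta: "Im \<eta> > 0"
  defines "D \<equiv> \<eta> - cnj \<eta>"
  shows "(\<eta> * exp (\<i> * s) - cnj \<eta> * exp (- (\<i> * s))) / D = rot \<eta> s $ 1 $ 1"
    and "(exp (\<i> * s) - exp (- (\<i> * s))) / D = rot \<eta> s $ 2 $ 1"
    and "(\<eta> * cnj \<eta> * (exp (- (\<i> * s)) - exp (\<i> * s))) / D = rot \<eta> s $ 1 $ 2"
    and "(\<eta> * exp (- (\<i> * s)) - cnj \<eta> * exp (\<i> * s)) / D = rot \<eta> s $ 2 $ 2"
proof -
  have e1: "exp (\<i> * s) = cos s + \<i> * sin s" by (rule exp_Euler)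
  have e2: "exp (- (\<i> * s)) = cos s - \<i> * sin s" by (rule exp_minus_Euler)
  have D: "D = 2 * \<i> * of_real (Im \<eta>)" by (simp add: D_def complex_eq_iff)
  have eta': "\<eta> = of_real (Re \<eta>) + \<i> * of_real (Im \<eta>)" "cnj \<eta> = of_real (Re \<eta>) - \<i> * of_real (Im \<eta>)"
    by (simp_all add: complex_eq_iff)
  have nrm: "\<eta> * cnj \<eta> = of_real ((cmod \<eta>)\<^sup>2)" by (rule complex_norm_square[symmetric])
  have "\<eta> * exp (\<i> * s) - cnj \<eta> * exp (- (\<i> * s))
      = 2 * \<i> * (cos s * of_real (Im \<eta>) + sin s * of_real (Re \<eta>))"
    unfolding e1 e2 by (subst eta'(1), subst eta'(2)) (simp add: algebra_simps)
  then show "(\<eta> * exp (\<i> * s) - cnj \<eta> * exp (- (\<i> * s))) / D = rot \<eta> s $ 1 $ 1"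
    using eta by (simp add: rot_def D field_simps)
  show "(exp (\<i> * s) - exp (- (\<i> * s))) / D = rot \<eta> s $ 2 $ 1"
    using eta unfolding e1 e2 D by (simp add: rot_def)
  have e3: "\<eta> * cnj \<eta> * (exp (- (\<i> * s)) - exp (\<i> * s)) = - (2 * \<i>) * of_real ((cmod \<eta>)\<^sup>2) * sin s"
    unfolding e1 e2 nrm by (simp add: algebra_simps)
  show "(\<eta> * cnj \<eta> * (exp (- (\<i> * s)) - exp (\<i> * s))) / D = rot \<eta> s $ 1 $ 2"
    unfolding e3 using eta by (simp add: rot_def D)
  have e4: "\<eta> * exp (- (\<i> * s)) - cnj \<eta> * exp (\<i> * s)
      = 2 * \<i> * (cos s * of_real (Im \<eta>) - sin s * of_real (Re \<eta>))"
    unfolding e1 e2 by (subst eta'(1), subst eta'(2)) (simp add: algebra_simps)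
  show "(\<eta> * exp (- (\<i> * s)) - cnj \<eta> * exp (\<i> * s)) / D = rot \<eta> s $ 2 $ 2"
    unfolding e4 D using eta by (simp add: rot_def field_simps)
qed

lemma compact_exp_bound:
  assumes "compact K"
  shows "\<exists>B. \<forall>z\<in>K. exp (c * cmod z) \<le> B"
proof -
  have "compact ((\<lambda>z. exp (c * cmod z)) ` K)"
    by (intro compact_continuous_image continuous_intros assms)
  then obtain B where "\<forall>x\<in>(\<lambda>z. exp (c * cmod z)) ` K. norm x \<le> B"
    using compact_imp_bounded bounded_iff by metis
  then show ?thesis by (intro exI[of _ B]) force
qed

text \<open>The matrices \<open>A n\<close> stand for \<open>M n (z / \<tau> n)\<close>.  The hypotheses \<open>der\<close> say that the derivative at
  \<open>0\<close> is \<open>j\<close> times a real symmetric matrix of trace one, with first row \<open>(p n, q n)\<close>; this normalisation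
  fixes the speed of the limiting rotation.  The hypotheses \<open>lower\<close> and \<open>upper\<close> bound the flux of
  the images of \<open>(\<eta>, 1)\<close> and of the Weyl vector \<open>(m n z, 1)\<close>; in the limit both concern the same
  vector, and \<open>positive_flux_rigidity\<close> applies to it.\<close>

proposition transfer_limit:
  fixes A :: "nat \<Rightarrow> complex \<Rightarrow> complex^2^2" and p q :: "nat \<Rightarrow> real" and m :: "nat \<Rightarrow> complex \<Rightarrow> complex"
    and K :: "complex set"
  assumes hol: "\<And>n i l. (\<lambda>z. A n z $ i $ l) holomorphic_on UNIV"
    and bd: "\<And>n z i l. cmod (A n z $ i $ l) \<le> exp (c * cmod z)" and c: "c \<ge> 0"
    and real: "\<And>n z i l. cnj (A n z $ i $ l) = A n (cnj z) $ i $ l"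
    and det1: "\<And>n z. det (A n z) = 1"
    and at0: "\<And>n. A n 0 = mat 1"
    and der: "\<And>n. ((\<lambda>z. A n z $ 1 $ 1) has_field_derivative - of_real (q n)) (at 0)"
      "\<And>n. ((\<lambda>z. A n z $ 1 $ 2) has_field_derivative - of_real (1 - p n)) (at 0)"
      "\<And>n. ((\<lambda>z. A n z $ 2 $ 1) has_field_derivative of_real (p n)) (at 0)"
      "\<And>n. ((\<lambda>z. A n z $ 2 $ 2) has_field_derivative of_real (q n)) (at 0)"
    and eta: "Im \<eta> > 0"
    and lower: "\<And>n z. Im z \<le> 0 \<Longrightarrow>
      flux (A n z $ 1 $ 1 * \<eta> + A n z $ 1 $ 2) (A n z $ 2 $ 1 * \<eta> + A n z $ 2 $ 2) \<ge> Im \<eta>"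
    and upper: "\<And>n z. Im z > 0 \<Longrightarrow>
      flux (A n z $ 1 $ 1 * m n z + A n z $ 1 $ 2) (A n z $ 2 $ 1 * m n z + A n z $ 2 $ 2) \<ge> 0"
    and m: "\<And>z. Im z > 0 \<Longrightarrow> (\<lambda>n. m n z) \<longlonglongrightarrow> \<eta>"
    and K: "compact K"
  shows "uniform_limit K (\<lambda>n z. A n z $ i $ l) (\<lambda>z. rot \<eta> (h_eta \<eta> * z) $ i $ l) sequentially"
proof -
  define h where "h = h_eta \<eta>"
  define f where "f i n z = A n z $ i $ 1 * \<eta> + A n z $ i $ 2" for i n z
  have f_hol: "f i n holomorphic_on UNIV" for i n
    unfolding f_def by (intro holomorphic_intros hol)
  have f_bd1: "cmod (f i n z) \<le> (cmod \<eta> + 1) * exp (c * cmod z)" for i n z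
  proof -
    have "cmod (f i n z) \<le> cmod (A n z $ i $ 1) * cmod \<eta> + cmod (A n z $ i $ 2)"
      unfolding f_def by (metis norm_mult norm_triangle_ineq)
    also have "\<dots> \<le> exp (c * cmod z) * cmod \<eta> + exp (c * cmod z)"
      by (intro add_mono mult_right_mono bd norm_ge_zero)
    finally show ?thesis by (simp add: algebra_simps)
  qed
  have f_bd: "\<exists>B. \<forall>n. \<forall>z\<in>K. cmod (f i n z) \<le> B" if "compact K" for K i
  proof -
    obtain B where B: "\<And>z. z \<in> K \<Longrightarrow> exp (c * cmod z) \<le> B" using compact_exp_bound[OF \<open>compact K\<close>, of c] by blast
    have "cmod (f i n z) \<le> (cmod \<eta> + 1) * B" if "z \<in> K" for n z
      using f_bd1[of i n z] mult_left_mono[OF B[OF that], of "cmod \<eta> + 1"] by simp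
    then show ?thesis by blast
  qed
  have sub: "\<exists>r' :: nat \<Rightarrow> nat. strict_mono r' \<and>
      (\<forall>x. (\<lambda>n. f 1 (r (r' n)) x) \<longlonglongrightarrow> \<eta> * exp (\<i> * h * x)) \<and>
      (\<forall>x. (\<lambda>n. f 2 (r (r' n)) x) \<longlonglongrightarrow> exp (\<i> * h * x))" if r: "strict_mono r" for r :: "nat \<Rightarrow> nat"
  proof -
    have bd1: "\<exists>B. \<forall>h\<in>range (\<lambda>n. f 1 (r n)). \<forall>z\<in>K. cmod (h z) \<le> B" if "compact K" "K \<subseteq> UNIV" for K
      using f_bd[OF that(1), of 1] by blast
    obtain h1 r1 where h1: "h1 holomorphic_on UNIV" "strict_mono (r1 :: nat \<Rightarrow> nat)"
      "\<And>x. (\<lambda>n. f 1 (r (r1 n)) x) \<longlonglongrightarrow> h1 x"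
      by (rule Montel[OF open_UNIV _ bd1, of "\<lambda>n. f 1 (r n)"]) (use f_hol in auto)
    have bd2: "\<exists>B. \<forall>h\<in>range (\<lambda>n. f 2 (r (r1 n))). \<forall>z\<in>K. cmod (h z) \<le> B" if "compact K" "K \<subseteq> UNIV" for K
      using f_bd[OF that(1), of 2] by blast
    obtain h2 r2 where h2: "h2 holomorphic_on UNIV" "strict_mono (r2 :: nat \<Rightarrow> nat)"
      "\<And>x. (\<lambda>n. f 2 (r (r1 (r2 n))) x) \<longlonglongrightarrow> h2 x"
      by (rule Montel[OF open_UNIV _ bd2, of "\<lambda>n. f 2 (r (r1 n))"]) (use f_hol in auto)
    define s where "s n = r (r1 (r2 n))" for n
    have s: "strict_mono s"
      using strict_mono_o[OF r strict_mono_o[OF h1(2) h2(2)]] by (simp add: s_def[abs_def] o_def)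
    have l1: "(\<lambda>n. f 1 (s n) x) \<longlonglongrightarrow> h1 x" for x
      using LIMSEQ_subseq_LIMSEQ[OF h1(3) h2(2)] by (simp add: o_def s_def)
    have l2: "(\<lambda>n. f 2 (s n) x) \<longlonglongrightarrow> h2 x" for x
      using h2(3) by (simp add: s_def)
    have start: "f 1 n 0 = \<eta>" "f 2 n 0 = 1" for n
      by (simp_all add: f_def at0)
    have h10: "h1 0 = \<eta>" using l1[of 0] by (simp add: start LIMSEQ_const_iff)
    have h20: "h2 0 = 1" using l2[of 0] by (simp add: start LIMSEQ_const_iff)
    have h2_bd: "cmod (h2 z) \<le> (cmod \<eta> + 1) * exp (c * cmod z)" for z
      by (rule Lim_bounded[OF tendsto_norm[OF l2]]) (use f_bd1 in auto)
    have flux_lim: "flux (h1 z) (h2 z) \<ge> x"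
      if "\<And>n. flux (g1 n) (g2 n) \<ge> x" "g1 \<longlonglongrightarrow> h1 z" "g2 \<longlonglongrightarrow> h2 z" for z x g1 g2
    proof (rule Lim_bounded2)
      show "(\<lambda>n. flux (g1 n) (g2 n)) \<longlonglongrightarrow> flux (h1 z) (h2 z)"
        unfolding flux_def by (intro tendsto_intros that)
    qed (use that(1) in auto)
    have low: "flux (h1 z) (h2 z) > 0" if "Im z \<le> 0" for z
    proof -
      have "flux (h1 z) (h2 z) \<ge> Im \<eta>"
        by (rule flux_lim[OF _ l1 l2]) (use lower[OF that] in \<open>simp add: f_def\<close>)
      then show ?thesis using eta by simp
    qed
    have upp: "flux (h1 z) (h2 z) \<ge> 0" if z: "Im z > 0" for z
    proof (rule flux_lim)
      let ?g = "\<lambda>i n. A (s n) z $ i $ 1 * m (s n) z + A (s n) z $ i $ 2"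
      show "flux (?g 1 n) (?g 2 n) \<ge> 0" for n by (rule upper[OF z])
      have ms: "(\<lambda>n. m (s n) z - \<eta>) \<longlonglongrightarrow> 0"
        using LIMSEQ_subseq_LIMSEQ[OF m[OF z] s] by (simp add: o_def LIM_zero_iff)
      have d: "(\<lambda>n. A (s n) z $ i $ 1 * (m (s n) z - \<eta>)) \<longlonglongrightarrow> 0" for i
      proof (rule Lim_null_comparison)
        show "(\<lambda>n. exp (c * cmod z) * cmod (m (s n) z - \<eta>)) \<longlonglongrightarrow> 0"
          by (rule tendsto_mult_right_zero, rule tendsto_norm_zero, rule ms)
        show "\<forall>\<^sub>F n in sequentially. norm (A (s n) z $ i $ 1 * (m (s n) z - \<eta>))
              \<le> exp (c * cmod z) * cmod (m (s n) z - \<eta>)"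
          by (intro always_eventually allI) (simp only: norm_mult, intro mult_right_mono bd norm_ge_zero)
      qed
      have eq: "?g i n = f i (s n) z + A (s n) z $ i $ 1 * (m (s n) z - \<eta>)" for i n
        by (simp add: f_def algebra_simps)
      show "?g 1 \<longlonglongrightarrow> h1 z" unfolding eq using tendsto_add[OF l1 d] by simp
      show "?g 2 \<longlonglongrightarrow> h2 z" unfolding eq using tendsto_add[OF l2 d] by simp
    qed
    \<comment> \<open>As \<open>A n\<close> is real, conjugation at \<open>cnj z\<close> gives the image of \<open>(cnj \<eta>, 1)\<close>; the determinant of the two images does not depend on \<open>z\<close>.\<close>
    have wronskian: "h1 z * cnj (h2 (cnj z)) - h2 z * cnj (h1 (cnj z)) = \<eta> - cnj \<eta>" for z
    proof (rule LIMSEQ_unique)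
      show "(\<lambda>n. f 1 (s n) z * cnj (f 2 (s n) (cnj z)) - f 2 (s n) z * cnj (f 1 (s n) (cnj z)))
          \<longlonglongrightarrow> h1 z * cnj (h2 (cnj z)) - h2 z * cnj (h1 (cnj z))"
        by (intro tendsto_intros l1 l2)
      have "f 1 n z * cnj (f 2 n (cnj z)) - f 2 n z * cnj (f 1 n (cnj z)) = (\<eta> - cnj \<eta>) * det (A n z)" for n
        by (simp add: f_def real det_2 algebra_simps)
      then show "(\<lambda>n. f 1 (s n) z * cnj (f 2 (s n) (cnj z)) - f 2 (s n) z * cnj (f 1 (s n) (cnj z)))
          \<longlonglongrightarrow> \<eta> - cnj \<eta>"
        by (simp add: det1)
    qed
    have D: "\<eta> - cnj \<eta> \<noteq> 0" using eta by (auto simp: complex_eq_iff)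
    have "h1 z \<noteq> 0 \<or> h2 z \<noteq> 0" for z using wronskian[of z] D by auto
    then obtain \<kappa> where k: "\<And>z. h1 z = \<eta> * exp (\<kappa> * z)" "\<And>z. h2 z = exp (\<kappa> * z)"
      using positive_flux_rigidity[OF h1(1) h2(1) h10 h20 h2_bd c low upp] by blast
    have Re_k: "Re \<kappa> = 0"
    proof -
      have "(\<eta> - cnj \<eta>) * (exp \<kappa> * cnj (exp \<kappa>)) = \<eta> - cnj \<eta>"
        using wronskian[of 1] by (simp add: k algebra_simps)
      then have "of_real ((cmod (exp \<kappa>))\<^sup>2) = (1 :: complex)"
        using D unfolding complex_norm_square by simp
      then have "cmod (exp \<kappa>) = 1" by (metis norm_ge_zero of_real_eq_1_iff power2_eq_1_iff abs_of_nonneg abs_minus_cancel zero_neq_one neg_0_le_iff_le le_minus_one_simps(3))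
      then show ?thesis by simp
    qed
    have bds: "\<exists>B. \<forall>n. \<forall>z\<in>K. cmod (f i (s n) z) \<le> B" if "compact K" for K i
      using f_bd[OF that, of i] by blast
    have dd: "(\<lambda>n. deriv (f 1 (s n)) 0) \<longlonglongrightarrow> deriv h1 0" "(\<lambda>n. deriv (f 2 (s n)) 0) \<longlonglongrightarrow> deriv h2 0"
      by (intro deriv_tendsto_of_uniform_limit[OF f_hol] vitali_uniform[OF open_UNIV f_hol bds] l1 l2; simp)+
    have df: "deriv (f 1 n) 0 = - of_real (q n) * \<eta> - of_real (1 - p n)"
      "deriv (f 2 n) 0 = of_real (p n) * \<eta> + of_real (q n)" for n
      unfolding f_def by (rule DERIV_imp_deriv, (rule derivative_eq_intros der refl)+, simp)+
    have dh: "deriv h1 0 = \<eta> * \<kappa>" "deriv h2 0 = \<kappa>"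
      unfolding k by (rule DERIV_imp_deriv, (rule derivative_eq_intros refl)+, simp)+
    have L1: "(\<lambda>n. - of_real (q (s n)) * \<eta> - of_real (1 - p (s n))) \<longlonglongrightarrow> \<eta> * \<kappa>"
      and L2: "(\<lambda>n. of_real (p (s n)) * \<eta> + of_real (q (s n))) \<longlonglongrightarrow> \<kappa>"
      using dd unfolding df dh by simp_all
    \<comment> \<open>The limits of \<open>p\<close> and \<open>q\<close> can be read off from the imaginary and real parts of \<open>L2\<close>; inserting them into \<open>L1\<close> gives a linear equation for \<open>P\<close>.\<close>
    define P where "P = Im \<kappa> / Im \<eta>"
    define Q where "Q = - P * Re \<eta>"
    have p: "(\<lambda>n. p (s n)) \<longlonglongrightarrow> P"
    proof -
      have "(\<lambda>n. Im (of_real (p (s n)) * \<eta> + of_real (q (s n))) / Im \<eta>) \<longlonglongrightarrow> P"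
        unfolding P_def using eta by (intro tendsto_intros L2) auto
      then show ?thesis using eta by simp
    qed
    have q: "(\<lambda>n. q (s n)) \<longlonglongrightarrow> Q"
    proof -
      have "(\<lambda>n. Re (of_real (p (s n)) * \<eta> + of_real (q (s n))) - p (s n) * Re \<eta>) \<longlonglongrightarrow> Re \<kappa> - P * Re \<eta>"
        by (intro tendsto_intros L2 p)
      then show ?thesis by (simp add: Re_k Q_def)
    qed
    have "\<eta> * \<kappa> = - of_real Q * \<eta> - of_real (1 - P)"
      by (rule LIMSEQ_unique[OF L1]) (intro tendsto_intros p q)
    then have "Re (\<eta> * \<kappa>) = Re (- of_real Q * \<eta> - of_real (1 - P))" by simp
    then have "- Im \<eta> * Im \<kappa> = - Q * Re \<eta> - (1 - P)" by (simp add: Re_k)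
    moreover have "Im \<kappa> = P * Im \<eta>" using eta by (simp add: P_def)
    ultimately have "P * (1 + (Re \<eta>)\<^sup>2 + (Im \<eta>)\<^sup>2) = 1"
      by (simp add: Q_def power2_eq_square algebra_simps)
    then have "P * (1 + (cmod \<eta>)\<^sup>2) = 1" by (simp add: cmod_power2 add.assoc)
    then have "P = 1 / (1 + (cmod \<eta>)\<^sup>2)"
      by (metis mult_zero_right nonzero_eq_divide_eq zero_neq_one)
    then have "Im \<kappa> = h" using eta by (simp add: P_def h_def h_eta_def field_simps)
    then have "\<kappa> = \<i> * of_real h" using Re_k by (simp add: complex_eq_iff)
    with l1 l2 k strict_mono_o[OF h1(2) h2(2)] show ?thesis
      by (intro exI[of _ "r1 \<circ> r2"]) (auto simp: s_def)
  qed
  have F1: "(\<lambda>n. f 1 n x) \<longlonglongrightarrow> \<eta> * exp (\<i> * h * x)" for x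
    by (rule tendsto_subsequence_principle) (use sub in blast)
  have F2: "(\<lambda>n. f 2 n x) \<longlonglongrightarrow> exp (\<i> * h * x)" for x
    by (rule tendsto_subsequence_principle) (use sub in blast)
  define D where "D = \<eta> - cnj \<eta>"
  have D: "D \<noteq> 0" using eta by (auto simp: D_def complex_eq_iff)
  \<comment> \<open>The entries are recovered from the images of the two eigenvectors \<open>(\<eta>, 1)\<close> and \<open>(cnj \<eta>, 1)\<close>.\<close>
  have e1: "A n z $ i $ 1 = (f i n z - cnj (f i n (cnj z))) / D" for i n z
    using D by (simp add: f_def real D_def field_simps)
  have e2: "A n z $ i $ 2 = (\<eta> * cnj (f i n (cnj z)) - cnj \<eta> * f i n z) / D" for i n z
    using D by (simp add: f_def real D_def field_simps)
  have cnj_exp: "cnj (exp (\<i> * h * cnj z)) = exp (- (\<i> * (h * z)))" for z :: complex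
    by (simp add: exp_cnj mult.assoc)
  note R = rot_from_eigenvectors[OF eta, folded D_def]
  have pt: "(\<lambda>n. A n z $ i $ l) \<longlonglongrightarrow> rot \<eta> (h * z) $ i $ l" for z :: complex and i l
  proof -
    have C1: "(\<lambda>n. cnj (f 1 n (cnj z))) \<longlonglongrightarrow> cnj \<eta> * exp (- (\<i> * (h * z)))"
      using tendsto_cnj[OF F1[of "cnj z"]] by (simp only: complex_cnj_mult cnj_exp)
    have C2: "(\<lambda>n. cnj (f 2 n (cnj z))) \<longlonglongrightarrow> exp (- (\<i> * (h * z)))"
      using tendsto_cnj[OF F2[of "cnj z"]] by (simp only: cnj_exp)
    note F1' = F1[of z, unfolded mult.assoc] and F2' = F2[of z, unfolded mult.assoc]
    have "(\<lambda>n. A n z $ 1 $ 1) \<longlonglongrightarrow> rot \<eta> (h * z) $ 1 $ 1"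
      unfolding e1 R(1)[symmetric] by (intro tendsto_intros C1 F1' D)
    moreover have "(\<lambda>n. A n z $ 2 $ 1) \<longlonglongrightarrow> rot \<eta> (h * z) $ 2 $ 1"
      unfolding e1 R(2)[symmetric] by (intro tendsto_intros C2 F2' D)
    moreover have "(\<lambda>n. A n z $ 1 $ 2) \<longlonglongrightarrow> rot \<eta> (h * z) $ 1 $ 2"
    proof -
      have "(\<lambda>n. A n z $ 1 $ 2) \<longlonglongrightarrow>
          (\<eta> * (cnj \<eta> * exp (- (\<i> * (h * z)))) - cnj \<eta> * (\<eta> * exp (\<i> * (h * z)))) / D"
        unfolding e2 by (intro tendsto_intros C1 F1' D)
      then show ?thesis unfolding R(3)[symmetric] by (simp add: algebra_simps)
    qed
    moreover have "(\<lambda>n. A n z $ 2 $ 2) \<longlonglongrightarrow> rot \<eta> (h * z) $ 2 $ 2"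
      unfolding e2 R(4)[symmetric] by (intro tendsto_intros C2 F2' D)
    ultimately show ?thesis using exhaust_2[of i] exhaust_2[of l] by auto
  qed
  show ?thesis
  proof (rule vitali_uniform[OF open_UNIV hol])
    show "\<exists>B. \<forall>n. \<forall>z\<in>K. cmod (A n z $ i $ l) \<le> B" if "compact K" "K \<subseteq> UNIV" for K
    proof -
      obtain B where "\<And>z. z \<in> K \<Longrightarrow> exp (c * cmod z) \<le> B" using compact_exp_bound[OF \<open>compact K\<close>, of c] by blast
      then show ?thesis using bd order_trans by metis
    qed
    show "(\<lambda>n. A n z $ i $ l) \<longlonglongrightarrow> rot \<eta> (h_eta \<eta> * z) $ i $ l" for z :: complex
      using pt by (simp add: h_def)
  qed (use K in auto)
qed

section \<open>Transfer matrices near the base point\<close>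

lemma flux_real_det1:
  fixes B :: "complex^2^2"
  assumes "\<And>i l. cnj (B $ i $ l) = B $ i $ l" "det B = 1"
  shows "flux ((B *v y) $ 1) ((B *v y) $ 2) = flux (y $ 1) (y $ 2)"
proof -
  have im: "Im (B $ i $ l) = 0" for i l
    using assms(1)[of i l] by (simp add: complex_eq_iff)
  have d: "Re (B $ 1 $ 1) * Re (B $ 2 $ 2) - Re (B $ 1 $ 2) * Re (B $ 2 $ 1) = 1"
    using arg_cong[OF assms(2), of Re] by (simp add: det_2 im)
  have "flux ((B *v y) $ 1) ((B *v y) $ 2)
     = (Re (B $ 1 $ 1) * Re (B $ 2 $ 2) - Re (B $ 1 $ 2) * Re (B $ 2 $ 1)) * flux (y $ 1) (y $ 2)"
    by (simp add: flux_def mat_vec_nth2 im algebra_simps)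
  then show ?thesis by (simp add: d)
qed

lemma tendsto_rot:
  fixes f :: "nat \<Rightarrow> complex"
  assumes "(f \<longlongrightarrow> x) F" "Im \<eta> > 0"
  shows "((\<lambda>t. rot \<eta> (f t) $ i $ l) \<longlongrightarrow> rot \<eta> x $ i $ l) F"
  using exhaust_2[of i] exhaust_2[of l] assms
  by (elim disjE) (auto simp: rot_def intro!: tendsto_intros tendsto_sin[OF assms(1)] tendsto_cos[OF assms(1)])

context jacobi_coeffs
begin

text \<open>The step matrix of the canonical system differs from the identity by at most \<open>2 |s|\<close> times the increment
  of \<open>len\<close>, in the operator norm belonging to the norm \<open>|x| + |y|\<close>, and the same holds for its
  inverse.\<close>

lemma rel_fund_bound_step:
  fixes \<xi> :: real
  defines "X \<equiv> (\<lambda>n s l. cmod (rel_fund \<xi> n s $ 1 $ l) + cmod (rel_fund \<xi> n s $ 2 $ l))"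
  shows "X (n + 1) s l \<le> exp (2 * cmod s * (len \<xi> (n + 1) - len \<xi> n)) * X n s l"
    and "X n s l \<le> exp (2 * cmod s * (len \<xi> (n + 1) - len \<xi> n)) * X (n + 1) s l"
proof -
  let ?r1 = "\<Phi> \<xi> n $ 1 $ 1" and ?r2 = "\<Phi> \<xi> n $ 1 $ 2"
  let ?rho = "len \<xi> (n + 1) - len \<xi> n"
  have key: "cmod (x - s * (?r1 * x + ?r2 * y) * ?r2) + cmod (y + s * (?r1 * x + ?r2 * y) * ?r1)
      \<le> exp (2 * cmod s * ?rho) * (cmod x + cmod y)" for x y s
  proof -
    let ?c = "s * (?r1 * x + ?r2 * y)"
    have "cmod (x - ?c * ?r2) + cmod (y + ?c * ?r1) \<le> (cmod x + cmod ?c * cmod ?r2) + (cmod y + cmod ?c * cmod ?r1)"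
      using norm_triangle_ineq4[of x "?c * ?r2"] norm_triangle_ineq[of y "?c * ?r1"]
      unfolding norm_mult[of ?c] by (rule add_mono)
    also have "\<dots> = cmod x + cmod y + cmod s * (cmod (?r1 * x + ?r2 * y) * (cmod ?r1 + cmod ?r2))"
      unfolding norm_mult[of s] by (simp add: algebra_simps)
    also have "\<dots> \<le> cmod x + cmod y + cmod s * (2 * ?rho * (cmod x + cmod y))"
    proof -
      have "cmod (?r1 * x + ?r2 * y) \<le> cmod ?r1 * cmod x + cmod ?r2 * cmod y"
        unfolding norm_mult[symmetric] by (rule norm_triangle_ineq)
      also have "\<dots> \<le> (cmod ?r1 + cmod ?r2) * (cmod x + cmod y)"
        by (simp add: algebra_simps)
      finally have "cmod (?r1 * x + ?r2 * y) * (cmod ?r1 + cmod ?r2)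
          \<le> (cmod ?r1 + cmod ?r2) * (cmod x + cmod y) * (cmod ?r1 + cmod ?r2)"
        by (rule mult_right_mono) simp
      also have "\<dots> = (cmod ?r1 + cmod ?r2)\<^sup>2 * (cmod x + cmod y)"
        by (simp add: power2_eq_square)
      also have "\<dots> \<le> (2 * ?rho) * (cmod x + cmod y)"
      proof (rule mult_right_mono)
        have "(cmod ?r1 + cmod ?r2)\<^sup>2 \<le> 2 * ((cmod ?r1)\<^sup>2 + (cmod ?r2)\<^sup>2)"
          using sum_squares_bound[of "cmod ?r1" "cmod ?r2"] by (simp add: power2_sum)
        then show "(cmod ?r1 + cmod ?r2)\<^sup>2 \<le> 2 * ?rho" by (simp add: len_step)
      qed simp
      finally show ?thesis by (intro add_left_mono mult_left_mono) auto
    qed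
    also have "\<dots> = (1 + 2 * cmod s * ?rho) * (cmod x + cmod y)" by (simp add: algebra_simps)
    also have "\<dots> \<le> exp (2 * cmod s * ?rho) * (cmod x + cmod y)"
      by (intro mult_right_mono exp_ge_add_one_self) auto
    finally show ?thesis .
  qed
  note st = rel_fund_step[of \<xi> n s l]
  show "X (n + 1) s l \<le> exp (2 * cmod s * ?rho) * X n s l"
    unfolding X_def st by (rule key)
  have inv: "?r1 * rel_fund \<xi> (n + 1) s $ 1 $ l + ?r2 * rel_fund \<xi> (n + 1) s $ 2 $ l
      = ?r1 * rel_fund \<xi> n s $ 1 $ l + ?r2 * rel_fund \<xi> n s $ 2 $ l"
    unfolding st by (simp add: algebra_simps)
  show "X n s l \<le> exp (2 * cmod s * ?rho) * X (n + 1) s l"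
    using key[of "rel_fund \<xi> (n + 1) s $ 1 $ l" "- s" "rel_fund \<xi> (n + 1) s $ 2 $ l"]
    unfolding inv X_def by (simp add: st)
qed

lemma rel_fund_bound: "cmod (rel_fund \<xi> n s $ i $ l) \<le> exp (2 * cmod s * \<bar>len \<xi> n\<bar>)"
proof -
  let ?X = "\<lambda>n. cmod (rel_fund \<xi> n s $ 1 $ l) + cmod (rel_fund \<xi> n s $ 2 $ l)"
  have "?X n \<le> exp (2 * cmod s * \<bar>len \<xi> n\<bar>)"
  proof (induction n rule: int_induct[of _ 0])
    case base
    show ?case using exhaust_2[of l] by auto
  next
    case (step1 n)
    have pos: "0 \<le> len \<xi> n" "len \<xi> n \<le> len \<xi> (n + 1)"
      using len_mono[of 0 n] len_mono[of n "n + 1"] step1(1) by auto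
    have "?X (n + 1) \<le> exp (2 * cmod s * (len \<xi> (n + 1) - len \<xi> n)) * ?X n"
      by (rule rel_fund_bound_step)
    also have "\<dots> \<le> exp (2 * cmod s * (len \<xi> (n + 1) - len \<xi> n)) * exp (2 * cmod s * \<bar>len \<xi> n\<bar>)"
      using step1 by (intro mult_left_mono) auto
    also have "\<dots> = exp (2 * cmod s * \<bar>len \<xi> (n + 1)\<bar>)"
      using pos by (simp add: algebra_simps flip: exp_add)
    finally show ?case .
  next
    case (step2 n)
    have neg: "len \<xi> n \<le> 0" "len \<xi> (n - 1) \<le> len \<xi> n"
      using len_mono[of n 0] len_mono[of "n - 1" n] step2(1) by auto
    have "?X (n - 1) \<le> exp (2 * cmod s * (len \<xi> n - len \<xi> (n - 1))) * ?X n"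
      using rel_fund_bound_step(2)[of \<xi> "n - 1" s l] by simp
    also have "\<dots> \<le> exp (2 * cmod s * (len \<xi> n - len \<xi> (n - 1))) * exp (2 * cmod s * \<bar>len \<xi> n\<bar>)"
      using step2 by (intro mult_left_mono) auto
    also have "\<dots> = exp (2 * cmod s * \<bar>len \<xi> (n - 1)\<bar>)"
      using neg by (simp add: algebra_simps flip: exp_add)
    finally show ?case .
  qed
  moreover have "cmod (rel_fund \<xi> n s $ i $ l) \<le> ?X n"
    using exhaust_2[of i] by auto
  ultimately show ?thesis by simp
qed

lemma rel_fund_derivative:
  fixes \<xi> :: real
  defines "r1 \<equiv> (\<lambda>i. Re (\<Phi> \<xi> (int i) $ 1 $ 1))" and "r2 \<equiv> (\<lambda>i. Re (\<Phi> \<xi> (int i) $ 1 $ 2))"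
  shows "((\<lambda>s. rel_fund \<xi> (int n) s $ 1 $ 1) has_field_derivative - of_real (\<Sum>i<n. r1 i * r2 i)) (at 0)"
    and "((\<lambda>s. rel_fund \<xi> (int n) s $ 1 $ 2) has_field_derivative - of_real (\<Sum>i<n. (r2 i)\<^sup>2)) (at 0)"
    and "((\<lambda>s. rel_fund \<xi> (int n) s $ 2 $ 1) has_field_derivative of_real (\<Sum>i<n. (r1 i)\<^sup>2)) (at 0)"
    and "((\<lambda>s. rel_fund \<xi> (int n) s $ 2 $ 2) has_field_derivative of_real (\<Sum>i<n. r1 i * r2 i)) (at 0)"
    and "len \<xi> (int n) = (\<Sum>i<n. (r1 i)\<^sup>2) + (\<Sum>i<n. (r2 i)\<^sup>2)"
proof (induction n)
  case 0
  show "((\<lambda>s. rel_fund \<xi> (int 0) s $ 1 $ 1) has_field_derivative - of_real (\<Sum>i<0. r1 i * r2 i)) (at 0)" by simp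
  show "((\<lambda>s. rel_fund \<xi> (int 0) s $ 1 $ 2) has_field_derivative - of_real (\<Sum>i<0. (r2 i)\<^sup>2)) (at 0)" by simp
  show "((\<lambda>s. rel_fund \<xi> (int 0) s $ 2 $ 1) has_field_derivative of_real (\<Sum>i<0. (r1 i)\<^sup>2)) (at 0)" by simp
  show "((\<lambda>s. rel_fund \<xi> (int 0) s $ 2 $ 2) has_field_derivative of_real (\<Sum>i<0. r1 i * r2 i)) (at 0)" by simp
  show "len \<xi> (int 0) = (\<Sum>i<0. (r1 i)\<^sup>2) + (\<Sum>i<0. (r2 i)\<^sup>2)" by simp
next
  case (Suc n)
  have N: "int (Suc n) = int n + 1" by simp
  have "\<Phi> \<xi> (int n) $ i $ l = of_real (Re (\<Phi> \<xi> (int n) $ i $ l))" for i l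
    using fund_real[of \<xi> "int n" i l] by (simp add: complex_eq_iff)
  then have r: "\<Phi> \<xi> (int n) $ 1 $ 1 = of_real (r1 n)" "\<Phi> \<xi> (int n) $ 1 $ 2 = of_real (r2 n)"
    by (simp_all add: r1_def r2_def)
  note I = Suc.IH(1-4)
  show "((\<lambda>s. rel_fund \<xi> (int (Suc n)) s $ 1 $ 1) has_field_derivative - of_real (\<Sum>i<Suc n. r1 i * r2 i)) (at 0)"
    unfolding N rel_fund_step r
    by (rule derivative_eq_intros I refl)+ (simp add: rel_fund_at_0 mult.commute)
  show "((\<lambda>s. rel_fund \<xi> (int (Suc n)) s $ 1 $ 2) has_field_derivative - of_real (\<Sum>i<Suc n. (r2 i)\<^sup>2)) (at 0)"
    unfolding N rel_fund_step r
    by (rule derivative_eq_intros I refl)+ (simp add: rel_fund_at_0 power2_eq_square)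
  show "((\<lambda>s. rel_fund \<xi> (int (Suc n)) s $ 2 $ 1) has_field_derivative of_real (\<Sum>i<Suc n. (r1 i)\<^sup>2)) (at 0)"
    unfolding N rel_fund_step r
    by (rule derivative_eq_intros I refl)+ (simp add: rel_fund_at_0 power2_eq_square)
  show "((\<lambda>s. rel_fund \<xi> (int (Suc n)) s $ 2 $ 2) has_field_derivative of_real (\<Sum>i<Suc n. r1 i * r2 i)) (at 0)"
    unfolding N rel_fund_step r
    by (rule derivative_eq_intros I refl)+ (simp add: rel_fund_at_0 mult.commute)
  show "len \<xi> (int (Suc n)) = (\<Sum>i<Suc n. (r1 i)\<^sup>2) + (\<Sum>i<Suc n. (r2 i)\<^sup>2)"
    unfolding N len_step r using Suc.IH(5) by simp
qed

text \<open>The factor \<open>adj2 (\<Phi> \<xi> n)\<close> is real of determinant one, and such matrices preserve the flux.\<close>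

lemma flux_rel_fund:
  "flux ((rel_fund \<xi> n s *v x) $ 1) ((rel_fund \<xi> n s *v x) $ 2)
    = flux ((\<Phi> (\<xi> + s) n *v x) $ 1) ((\<Phi> (\<xi> + s) n *v x) $ 2)"
proof -
  have "cnj (adj2 (\<Phi> \<xi> n) $ i $ l) = adj2 (\<Phi> \<xi> n) $ i $ l" for i l
    using exhaust_2[of i] exhaust_2[of l] by (auto simp: fund_real)
  then show ?thesis
    unfolding rel_fund_def matrix_vector_mul_assoc[symmetric] by (intro flux_real_det1) simp_all
qed

end

locale boundary_value_jacobi = limit_point_jacobi +
  fixes \<xi> :: real and \<eta> :: complex
  assumes boundary_value: "((\<lambda>y. m_plus a b (of_real \<xi> + \<i> * of_real y)) \<longlongrightarrow> \<eta>) (at_right (0::real))"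
    and Im_eta: "Im \<eta> > 0"
begin

lemma len_ge_1: "n \<ge> 1 \<Longrightarrow> len \<xi> n \<ge> 1"
  using len_mono[of 1 n \<xi>] len_step[of \<xi> 0] by simp

lemma len_filterlim: "filterlim (len \<xi>) at_top at_top"
  unfolding filterlim_at_top
proof
  fix C
  have "\<forall>\<^sub>F N in sequentially. C \<le> len \<xi> (int N)"
    using len_at_top[of \<xi>] by (simp add: filterlim_at_top)
  then obtain N where "C \<le> len \<xi> (int N)"
    by (auto simp: eventually_sequentially)
  then have "C \<le> len \<xi> n" if "n \<ge> int N" for n
    using len_mono[OF that, of \<xi>] by simp
  then show "\<forall>\<^sub>F n in at_top. C \<le> len \<xi> n"
    unfolding eventually_at_top_linorder by blast
qed

text \<open>The upper half-plane enters through the Weyl vectors \<open>(m_plus, 1)\<close>, whose flux stays nonnegative, and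
  the lower one through Green's identity.  The indices start at \<open>1\<close>, since the length \<open>len \<xi> 0\<close>
  vanishes.\<close>

proposition rel_fund_limit:
  fixes K :: "complex set"
  assumes "compact K"
  shows "uniform_limit K (\<lambda>n z. rel_fund \<xi> (int (Suc n)) (z / of_real (len \<xi> (int (Suc n)))) $ i $ l)
    (\<lambda>z. rot \<eta> (h_eta \<eta> * z) $ i $ l) sequentially"
proof -
  define t where "t n = len \<xi> (int (Suc n))" for n
  have t1: "t n \<ge> 1" for n unfolding t_def by (intro len_ge_1) simp
  then have t0: "t n > 0" for n by (metis less_le_trans zero_less_one)
  have t_top: "filterlim t at_top sequentially"
    unfolding t_def using len_at_top[of \<xi>] by (rule filterlim_compose) (rule filterlim_Suc)
  define A where "A n z = rel_fund \<xi> (int (Suc n)) (z / of_real (t n))" for n z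
  define r1 where "r1 i = Re (\<Phi> \<xi> (int i) $ 1 $ 1)" for i
  define r2 where "r2 i = Re (\<Phi> \<xi> (int i) $ 1 $ 2)" for i
  \<comment> \<open>The sum of the rank-one matrices \<open>r r\<^sup>T\<close> over \<open>r = (r1 i, r2 i)\<close>, divided by its trace \<open>t n\<close>, has first row \<open>(p n, q n)\<close>.\<close>
  define p where "p n = (\<Sum>i<Suc n. (r1 i)\<^sup>2) / t n" for n
  define q where "q n = (\<Sum>i<Suc n. r1 i * r2 i) / t n" for n
  have p1: "1 - p n = (\<Sum>i<Suc n. (r2 i)\<^sup>2) / t n" for n
  proof -
    have "t n = (\<Sum>i<Suc n. (r1 i)\<^sup>2) + (\<Sum>i<Suc n. (r2 i)\<^sup>2)"
      unfolding t_def r1_def r2_def by (rule rel_fund_derivative(5))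
    then show ?thesis using t0[of n] by (simp add: p_def field_simps)
  qed
  have chain: "((\<lambda>z. A n z $ i $ l) has_field_derivative (d / of_real (t n))) (at 0)"
    if "((\<lambda>s. rel_fund \<xi> (int (Suc n)) s $ i $ l) has_field_derivative d) (at 0)" for n i l d
  proof -
    have "((\<lambda>z. z / of_real (t n)) has_field_derivative (1 / of_real (t n))) (at (0 :: complex))"
      by (rule DERIV_cdivide[OF DERIV_ident])
    from DERIV_chain2[OF _ this, of "\<lambda>s. rel_fund \<xi> (int (Suc n)) s $ i $ l" d] that
    show ?thesis by (simp add: A_def)
  qed
  define m where "m n z = m_plus a b (of_real \<xi> + z / of_real (t n))" for n z
  have m_lim: "(\<lambda>n. m n z) \<longlonglongrightarrow> \<eta>" if "Im z > 0" for z
    unfolding m_def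
  proof (rule herglotz_rescaling[of "\<lambda>w. m_plus a b (of_real \<xi> + w)"])
    show "(\<lambda>w. m_plus a b (of_real \<xi> + w)) holomorphic_on {z. 0 < Im z}"
      by (intro holomorphic_on_composed[OF m_plus_holomorphic] holomorphic_intros) auto
    show "0 \<le> Im (m_plus a b (of_real \<xi> + w))" if "Im w > 0" for w
      using m_plus_flux[of "of_real \<xi> + w" 0] that by (simp add: flux_def)
  qed (use boundary_value Im_eta t_top t0 that in auto)
  have eval: "A n z $ i $ 1 * x + A n z $ i $ 2 = (A n z *v vector [x, 1]) $ i" for n z i x
    by (simp add: mat_vec_nth2)
  have "uniform_limit K (\<lambda>n z. A n z $ i $ l) (\<lambda>z. rot \<eta> (h_eta \<eta> * z) $ i $ l) sequentially"
  proof (rule transfer_limit[where c = 2 and p = p and q = q and m = m])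
    show "(\<lambda>z. A n z $ i $ l) holomorphic_on UNIV" for n i l
      unfolding A_def using t0[of n] by (intro rel_fund_holomorphic holomorphic_intros) auto
    show "cmod (A n z $ i $ l) \<le> exp (2 * cmod z)" for n z i l
      using rel_fund_bound[of \<xi> "int (Suc n)" "z / of_real (t n)" i l] t0[of n]
      by (simp add: A_def norm_divide flip: t_def del: of_nat_Suc)
    show "cnj (A n z $ i $ l) = A n (cnj z) $ i $ l" for n z i l
      by (simp add: A_def cnj_rel_fund)
    show "det (A n z) = 1" for n z by (simp add: A_def)
    show "A n 0 = mat 1" for n by (simp add: A_def rel_fund_at_0)
    show "((\<lambda>z. A n z $ 1 $ 1) has_field_derivative - of_real (q n)) (at 0)" for n
      using chain[OF rel_fund_derivative(1)] unfolding q_def r1_def r2_def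
      by (simp only: of_real_divide minus_divide_left)
    show "((\<lambda>z. A n z $ 1 $ 2) has_field_derivative - of_real (1 - p n)) (at 0)" for n
      using chain[OF rel_fund_derivative(2)] unfolding p1 r1_def r2_def
      by (simp only: of_real_divide minus_divide_left)
    show "((\<lambda>z. A n z $ 2 $ 1) has_field_derivative of_real (p n)) (at 0)" for n
      using chain[OF rel_fund_derivative(3)] unfolding p_def r1_def r2_def
      by (simp only: of_real_divide)
    show "((\<lambda>z. A n z $ 2 $ 2) has_field_derivative of_real (q n)) (at 0)" for n
      using chain[OF rel_fund_derivative(4)] unfolding q_def r1_def r2_def
      by (simp only: of_real_divide)
    show "Im \<eta> \<le> flux (A n z $ 1 $ 1 * \<eta> + A n z $ 1 $ 2) (A n z $ 2 $ 1 * \<eta> + A n z $ 2 $ 2)"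
      if "Im z \<le> 0" for n z
    proof -
      let ?s = "\<lambda>i. (cmod ((\<Phi> (\<xi> + z / of_real (t n)) (int i) *v vector [\<eta>, 1]) $ 1))\<^sup>2"
      have "Im (z / of_real (t n)) * (\<Sum>i<Suc n. ?s i) \<le> 0"
        using that t0[of n] by (intro mult_nonpos_nonneg sum_nonneg) (auto simp: Im_divide_of_real divide_nonpos_pos)
      then show ?thesis
        unfolding eval unfolding A_def flux_rel_fund flux_sum by (simp add: flux_def)
    qed
    show "0 \<le> flux (A n z $ 1 $ 1 * m n z + A n z $ 1 $ 2) (A n z $ 2 $ 1 * m n z + A n z $ 2 $ 2)"
      if "Im z > 0" for n z
    proof -
      have "Im (\<xi> + z / of_real (t n)) > 0"
        using that t0[of n] by (simp add: Im_divide_of_real)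
      from m_plus_flux[OF this, of "Suc n"] show ?thesis
        unfolding eval unfolding A_def flux_rel_fund m_def by simp
    qed
  qed (use Im_eta m_lim assms in auto)
  then show ?thesis by (simp add: A_def t_def)
qed

text \<open>The form of the limit that is needed for index sequences that are only bounded below.  Where the index is
  large, the locally uniform limit \<open>rel_fund_limit\<close> applies; the finitely many remaining indices
  contribute matrices close to the identity, since \<open>s\<close> tends to \<open>0\<close>.\<close>

lemma rel_fund_continuous_limit:
  fixes k :: "nat \<Rightarrow> int" and s :: "nat \<Rightarrow> complex" and x :: complex
  assumes k: "bdd_below (range k)" and s: "s \<longlonglongrightarrow> 0" and x: "(\<lambda>j. s j * of_real (len \<xi> (k j))) \<longlonglongrightarrow> x"
  shows "(\<lambda>j. rel_fund \<xi> (k j) (s j) $ i $ l) \<longlonglongrightarrow> rot \<eta> (h_eta \<eta> * x) $ i $ l"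
proof -
  define G where "G c u = cmod (rel_fund \<xi> c u $ i $ l - rot \<eta> (h_eta \<eta> * (u * of_real (len \<xi> c))) $ i $ l)" for c and u :: complex
  have "(\<lambda>j. G (k j) (s j)) \<longlonglongrightarrow> 0"
  proof (rule order_tendstoI)
    fix e :: real assume "e < 0"
    then show "\<forall>\<^sub>F j in sequentially. e < G (k j) (s j)"
      by (intro always_eventually allI) (simp add: G_def less_le_trans)
  next
    fix e :: real assume e: "0 < e"
    define R where "R = cmod x + 1"
    have ev_R: "\<forall>\<^sub>F j in sequentially. cmod (s j * of_real (len \<xi> (k j))) < R"
      using order_tendstoD(2)[OF tendsto_norm[OF x], of R] by (simp add: R_def)
    have "\<forall>\<^sub>F n in sequentially. \<forall>z::complex\<in>cball 0 R.
        dist (rel_fund \<xi> (int (Suc n)) (z / of_real (len \<xi> (int (Suc n)))) $ i $ l) (rot \<eta> (h_eta \<eta> * z) $ i $ l) < e"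
      by (rule uniform_limitD[OF rel_fund_limit[OF compact_cball] e])
    then obtain N where N: "\<forall>n\<ge>N. \<forall>z::complex\<in>cball 0 R.
        dist (rel_fund \<xi> (int (Suc n)) (z / of_real (len \<xi> (int (Suc n)))) $ i $ l) (rot \<eta> (h_eta \<eta> * z) $ i $ l) < e"
      unfolding eventually_sequentially by blast
    have large: "G c u < e" if "c > int N" "cmod (u * of_real (len \<xi> c)) < R" for c and u :: complex
    proof -
      define n where "n = nat c - 1"
      have n: "c = int (Suc n)" "n \<ge> N" using that(1) by (auto simp: n_def)
      have "len \<xi> c > 0" using len_ge_1[of c] n by simp
      then show ?thesis
        using N[rule_format, OF n(2), of "u * of_real (len \<xi> c)"] that(2)
        unfolding n(1)[symmetric] by (simp add: G_def dist_norm)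
    qed
    obtain c0 where c0: "\<And>j. c0 \<le> k j" using k by (auto simp: bdd_below_def)
    have "\<forall>\<^sub>F j in sequentially. G c (s j) < e" for c
    proof -
      have "isCont (\<lambda>u. rel_fund \<xi> c u $ i $ l) 0"
        using holomorphic_on_imp_continuous_on[OF rel_fund_holomorphic[OF holomorphic_on_id, of \<xi> c i l UNIV]]
        by (simp add: continuous_on_eq_continuous_at id_def)
      then have "(\<lambda>j. rel_fund \<xi> c (s j) $ i $ l) \<longlonglongrightarrow> rel_fund \<xi> c 0 $ i $ l"
        using s by (rule isCont_tendsto_compose)
      moreover have "(\<lambda>j. rot \<eta> (h_eta \<eta> * (s j * of_real (len \<xi> c))) $ i $ l)
          \<longlonglongrightarrow> rot \<eta> (h_eta \<eta> * ((0 :: complex) * of_real (len \<xi> c))) $ i $ l"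
        by (intro tendsto_rot tendsto_intros s Im_eta)
      ultimately have "(\<lambda>j. G c (s j)) \<longlonglongrightarrow> cmod (rel_fund \<xi> c 0 $ i $ l - rot \<eta> 0 $ i $ l)"
        unfolding G_def by (intro tendsto_norm tendsto_diff) simp_all
      moreover have "rot \<eta> 0 = mat 1" by (intro mat2_eqI) (simp_all add: rot_def)
      ultimately have "(\<lambda>j. G c (s j)) \<longlonglongrightarrow> 0" by (simp add: rel_fund_at_0)
      then show ?thesis using e by (rule order_tendstoD)
    qed
    then have "\<forall>\<^sub>F j in sequentially. \<forall>c\<in>{c0..int N}. G c (s j) < e"
      by (intro eventually_ball_finite) auto
    with ev_R show "\<forall>\<^sub>F j in sequentially. G (k j) (s j) < e"
    proof eventually_elim
      case (elim j)
      then show ?case using large[of "k j" "s j"] c0[of j] by (cases "k j \<le> int N") auto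
    qed
  qed
  then have "(\<lambda>j. rel_fund \<xi> (k j) (s j) $ i $ l - rot \<eta> (h_eta \<eta> * (s j * of_real (len \<xi> (k j)))) $ i $ l) \<longlonglongrightarrow> 0"
    unfolding G_def by (rule tendsto_norm_zero_cancel)
  moreover have "(\<lambda>j. rot \<eta> (h_eta \<eta> * (s j * of_real (len \<xi> (k j)))) $ i $ l) \<longlonglongrightarrow> rot \<eta> (h_eta \<eta> * x) $ i $ l"
    by (intro tendsto_rot tendsto_intros x Im_eta)
  ultimately show ?thesis
    using tendsto_add by fastforce
qed

end

section \<open>The rescaled kernel\<close>

text \<open>The sesquilinear form \<open>x\<^sup>* j y\<close>.\<close>

definition jform :: "complex^2 \<Rightarrow> complex^2 \<Rightarrow> complex" where
  "jform x y = cnj (x $ 2) * y $ 1 - cnj (x $ 1) * y $ 2"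

lemma jform_real_det1:
  fixes B :: "complex^2^2"
  assumes "\<And>i l. cnj (B $ i $ l) = B $ i $ l" "det B = 1"
  shows "jform (B *v x) (B *v y) = jform x y"
proof -
  have "jform (B *v x) (B *v y) = det B * jform x y"
    by (simp add: jform_def mat_vec_nth2 assms(1) det_2 algebra_simps)
  then show ?thesis by (simp add: assms(2))
qed

lemma scaleR_nth2:
  "(r *\<^sub>R (x :: complex^2)) $ i = of_real r * x $ i"
  "(r *\<^sub>R (H :: complex^2^2)) $ i $ l = of_real r * H $ i $ l"
  by (simp_all add: scaleR_conv_of_real[where 'a = complex])

lemma jform_scaleR:
  fixes A B :: "complex^2^2"
  shows "jform (A *v (r *\<^sub>R x)) (B *v (r *\<^sub>R x)) = of_real (r\<^sup>2) * jform (A *v x) (B *v x)"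
  unfolding jform_def mat_vec_nth2 scaleR_nth2 by (simp add: power2_eq_square algebra_simps)

lemma sesq_form_scaleR: "sesq_form H (r *\<^sub>R x) (r *\<^sub>R x) = of_real (r\<^sup>2) * sesq_form H x x"
  unfolding sesq_form_def sum_2 mat_vec_nth2 scaleR_nth2 by (simp add: power2_eq_square algebra_simps)

lemma H_ring_form:
  assumes "cnj (x $ 1) = x $ 1" "cnj (x $ 2) = x $ 2"
  shows "sesq_form (H_ring \<eta>) x x
    = ((x $ 1)\<^sup>2 - 2 * Re \<eta> * (x $ 1) * (x $ 2) + (cmod \<eta>)\<^sup>2 * (x $ 2)\<^sup>2) / (1 + (cmod \<eta>)\<^sup>2)"
proof -
  define r where "r = 1 / (1 + (cmod \<eta>)\<^sup>2)"
  have "sesq_form (H_ring \<eta>) x x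
    = of_real r * ((x $ 1)\<^sup>2 - 2 * Re \<eta> * (x $ 1) * (x $ 2) + (cmod \<eta>)\<^sup>2 * (x $ 2)\<^sup>2)"
    unfolding H_ring_def r_def[symmetric] sesq_form_def sum_2 mat_vec_nth2 scaleR_nth2
    by (simp add: assms power2_eq_square algebra_simps)
  then show ?thesis by (simp add: r_def)
qed

text \<open>Completing the square shows that \<open>H_ring \<eta>\<close> is positive definite on real vectors for \<open>\<eta>\<close> off the
  real axis.\<close>

lemma H_ring_form_nonzero:
  assumes x: "cnj (x $ 1) = x $ 1" "cnj (x $ 2) = x $ 2" "x \<noteq> 0" and eta: "Im \<eta> > 0"
  shows "sesq_form (H_ring \<eta>) x x \<noteq> 0"
proof
  assume 0: "sesq_form (H_ring \<eta>) x x = 0"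
  define s t where "s = Re (x $ 1)" and "t = Re (x $ 2)"
  have st: "x $ 1 = of_real s" "x $ 2 = of_real t"
    using x(1,2) by (simp_all add: s_def t_def complex_eq_iff)
  have "1 + (cmod \<eta>)\<^sup>2 > 0" by (simp add: add_pos_nonneg)
  then have nz: "1 + (cmod \<eta>)\<^sup>2 \<noteq> 0" by simp
  let ?Q = "s\<^sup>2 - 2 * Re \<eta> * s * t + (cmod \<eta>)\<^sup>2 * t\<^sup>2"
  have "sesq_form (H_ring \<eta>) x x = of_real (?Q / (1 + (cmod \<eta>)\<^sup>2))"
    unfolding H_ring_form[OF x(1,2)] st by simp
  then have "of_real (?Q / (1 + (cmod \<eta>)\<^sup>2)) = (0 :: complex)"
    by (simp only: 0)
  then have "?Q / (1 + (cmod \<eta>)\<^sup>2) = 0"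
    by (simp only: of_real_eq_0_iff)
  then have "?Q = 0" using nz by simp
  then have "(s - Re \<eta> * t)\<^sup>2 + (Im \<eta> * t)\<^sup>2 = 0"
    unfolding cmod_power2 by (simp add: power2_eq_square algebra_simps)
  then have "s - Re \<eta> * t = 0" "Im \<eta> * t = 0"
    by (simp_all add: sum_power2_eq_zero_iff)
  then have "t = 0" "s = 0" using eta by auto
  then have "x = 0" using st by (intro vec2_eqI) auto
  with x(3) show False by simp
qed

text \<open>Here the sine kernel appears.  Since \<open>rot\<close> is a real one-parameter group in the symplectic group, the left
  side is \<open>x\<^sup>* j rot(z - cnj w) x\<close>.  Its cosine part \<open>x\<^sup>* j x\<close> vanishes for real \<open>x\<close>,
  and its sine part involves \<open>j G = - H / h\<close>.\<close>

lemma jform_rot: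
  assumes x: "cnj (x $ 1) = x $ 1" "cnj (x $ 2) = x $ 2" and eta: "Im \<eta> > 0"
  shows "jform (rot \<eta> w *v x) (rot \<eta> z *v x)
    = sin (cnj w - z) / of_real (h_eta \<eta>) * sesq_form (H_ring \<eta>) x x"
proof -
  have h: "of_real (h_eta \<eta>) = (of_real (Im \<eta>) / of_real (1 + (cmod \<eta>)\<^sup>2) :: complex)"
    by (simp add: h_eta_def)
  have nz: "of_real (1 + (cmod \<eta>)\<^sup>2) \<noteq> (0 :: complex)"
    by (metis add_pos_nonneg less_irrefl of_real_eq_0_iff zero_le_power2 zero_less_one)
  define x1 x2 where "x1 = x $ 1" and "x2 = x $ 2"
  define \<alpha> \<beta> \<gamma> :: complex
    where "\<alpha> = of_real (Re \<eta> / Im \<eta>)" and "\<beta> = of_real ((cmod \<eta>)\<^sup>2 / Im \<eta>)" and "\<gamma> = of_real (1 / Im \<eta>)"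
  have rot: "rot \<eta> s = mat2 (cos s + sin s * \<alpha>) (- sin s * \<beta>) (sin s * \<gamma>) (cos s - sin s * \<alpha>)" for s
    by (simp add: rot_def \<alpha>_def \<beta>_def \<gamma>_def)
  have cj: "cnj \<alpha> = \<alpha>" "cnj \<beta> = \<beta>" "cnj \<gamma> = \<gamma>" "cnj (sin w) = sin (cnj w)" "cnj (cos w) = cos (cnj w)"
    by (simp_all add: \<alpha>_def \<beta>_def \<gamma>_def cnj_sin cnj_cos)
  have xr: "cnj x1 = x1" "cnj x2 = x2" using x by (simp_all add: x1_def x2_def)
  have "jform (rot \<eta> w *v x) (rot \<eta> z *v x) = sin (cnj w - z) * (\<gamma> * x1\<^sup>2 - 2 * \<alpha> * x1 * x2 + \<beta> * x2\<^sup>2)"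
    unfolding rot jform_def sin_diff
    unfolding mat_vec_nth2 mat2_nth x1_def[symmetric] x2_def[symmetric]
    by (simp add: cj xr power2_eq_square algebra_simps)
  also have "\<gamma> * x1\<^sup>2 - 2 * \<alpha> * x1 * x2 + \<beta> * x2\<^sup>2
      = (x1\<^sup>2 - 2 * Re \<eta> * x1 * x2 + (cmod \<eta>)\<^sup>2 * x2\<^sup>2) / of_real (Im \<eta>)"
    using eta by (simp add: \<alpha>_def \<beta>_def \<gamma>_def add_divide_distrib diff_divide_distrib)
  also have "\<dots> = sesq_form (H_ring \<eta>) x x / of_real (h_eta \<eta>)"
    unfolding H_ring_form[OF x] h x1_def x2_def using nz eta by simp
  finally show ?thesis by simp
qed

lemma rot_diff:
  assumes "Im \<eta> > 0"
  shows "rot \<eta> x ** adj2 (rot \<eta> y) = rot \<eta> (x - y)"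
proof -
  define \<alpha> \<beta> \<gamma> :: complex
    where "\<alpha> = of_real (Re \<eta> / Im \<eta>)" and "\<beta> = of_real ((cmod \<eta>)\<^sup>2 / Im \<eta>)" and "\<gamma> = of_real (1 / Im \<eta>)"
  have rot: "rot \<eta> s = mat2 (cos s + sin s * \<alpha>) (- sin s * \<beta>) (sin s * \<gamma>) (cos s - sin s * \<alpha>)" for s
    by (simp add: rot_def \<alpha>_def \<beta>_def \<gamma>_def)
  have "(cmod \<eta>)\<^sup>2 / Im \<eta> * (1 / Im \<eta>) = 1 + Re \<eta> / Im \<eta> * (Re \<eta> / Im \<eta>)"
    unfolding cmod_power2 using assms by (simp add: field_simps power2_eq_square)
  from arg_cong[OF this, of "of_real :: real \<Rightarrow> complex"] have rel: "\<beta> * \<gamma> = 1 + \<alpha> * \<alpha>"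
    unfolding \<alpha>_def \<beta>_def \<gamma>_def by (simp only: of_real_mult of_real_add of_real_1)
  show ?thesis
  proof (rule mat2_eqI)
    have "(rot \<eta> x ** adj2 (rot \<eta> y)) $ 1 $ 1
      = cos x * cos y + (sin x * cos y - cos x * sin y) * \<alpha> + sin x * sin y * (\<beta> * \<gamma> - \<alpha> * \<alpha>)"
      by (simp add: mat_mult_nth2 rot algebra_simps)
    then show "(rot \<eta> x ** adj2 (rot \<eta> y)) $ 1 $ 1 = rot \<eta> (x - y) $ 1 $ 1"
      by (simp add: rel rot sin_diff cos_diff)
    have "(rot \<eta> x ** adj2 (rot \<eta> y)) $ 2 $ 2
      = cos x * cos y - (sin x * cos y - cos x * sin y) * \<alpha> + sin x * sin y * (\<beta> * \<gamma> - \<alpha> * \<alpha>)"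
      by (simp add: mat_mult_nth2 rot algebra_simps)
    then show "(rot \<eta> x ** adj2 (rot \<eta> y)) $ 2 $ 2 = rot \<eta> (x - y) $ 2 $ 2"
      by (simp add: rel rot sin_diff cos_diff)
  qed (simp_all add: mat_mult_nth2 rot sin_diff algebra_simps)
qed

context jacobi_coeffs
begin

definition rel_transfer :: "real \<Rightarrow> int \<Rightarrow> int \<Rightarrow> complex \<Rightarrow> complex^2^2" where
  "rel_transfer \<xi> k n s = rel_fund \<xi> n s ** adj2 (rel_fund \<xi> k s)"

lemma T_first_column: "T k (\<xi> + s) n $ i $ 1 = (\<Phi> \<xi> n *v (rel_transfer \<xi> k n s *v vvec a b \<xi> k)) $ i"
proof -
  have "T k (\<xi> + s) n = \<Phi> \<xi> n ** (rel_transfer \<xi> k n s ** adj2 (\<Phi> \<xi> k))"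
    by (simp add: fund_shift adj2_mult rel_transfer_def matrix_mul_assoc)
  moreover have "(M ** adj2 (\<Phi> \<xi> k)) $ i $ 1 = (M *v vvec a b \<xi> k) $ i" for M :: "complex^2^2" and i
    by (simp add: mat_mult_nth2 mat_vec_nth2 vvec_eq)
  ultimately show ?thesis
    by (simp add: matrix_mul_assoc matrix_vector_mul_assoc)
qed

text \<open>The real symplectic matrix \<open>\<Phi> \<xi> n\<close> on the left drops out of \<open>jform\<close>, while the inverse
  of \<open>\<Phi> \<xi> k\<close> on the right turns the first basis vector into \<open>vvec\<close>.\<close>

lemma kernel_fn_jform:
  "(cnj (\<xi> + s') - (\<xi> + s)) * kernel_fn a b k n (\<xi> + s) (\<xi> + s')
    = jform (rel_transfer \<xi> k n s' *v vvec a b \<xi> k) (rel_transfer \<xi> k n s *v vvec a b \<xi> k)"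
proof -
  have "(cnj (\<xi> + s') - (\<xi> + s)) * kernel_fn a b k n (\<xi> + s) (\<xi> + s')
    = cnj (T k (\<xi> + s') n $ 2 $ 1) * T k (\<xi> + s) n $ 1 $ 1 - cnj (T k (\<xi> + s') n $ 1 $ 1) * T k (\<xi> + s) n $ 2 $ 1"
    unfolding kernel_fn_eq christoffel_darboux[symmetric] by (simp add: j_form_nth)
  also have "\<dots> = jform (\<Phi> \<xi> n *v (rel_transfer \<xi> k n s' *v vvec a b \<xi> k))
      (\<Phi> \<xi> n *v (rel_transfer \<xi> k n s *v vvec a b \<xi> k))"
    unfolding T_first_column by (simp add: jform_def)
  also have "\<dots> = jform (rel_transfer \<xi> k n s' *v vvec a b \<xi> k) (rel_transfer \<xi> k n s *v vvec a b \<xi> k)"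
    by (rule jform_real_det1) (simp_all add: fund_real)
  finally show ?thesis .
qed

lemma vvec_real: "cnj (vvec a b \<xi> k $ i) = vvec a b \<xi> k $ i"
  using exhaust_2[of i] by (auto simp: vvec_eq fund_real)

lemma vvec_nonzero: "vvec a b \<xi> k \<noteq> 0"
proof
  assume 0: "vvec a b \<xi> k = 0"
  have "\<Phi> \<xi> k $ 2 $ 2 = 0" "\<Phi> \<xi> k $ 2 $ 1 = 0"
    using arg_cong[OF 0, of "\<lambda>v. v $ 1"] arg_cong[OF 0, of "\<lambda>v. v $ 2"] by (simp_all add: vvec_eq)
  then show False using det_fund_entries[of \<xi> k] by simp
qed

end

locale kernel_scaling = boundary_value_jacobi +
  fixes k n :: "nat \<Rightarrow> int" and \<sigma> :: real
  assumes ratio: "(\<lambda>l. len \<xi> (k l) / len \<xi> (n l)) \<longlonglongrightarrow> \<sigma>" and sigma: "\<sigma> < 1"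
    and k_bd: "bdd_below (range k)" and n_top: "filterlim n at_top sequentially"
begin

definition gap :: "nat \<Rightarrow> real" where
  "gap l = len \<xi> (n l) - len \<xi> (k l)"

definition resc :: "nat \<Rightarrow> complex \<Rightarrow> complex" where
  "resc l z = z / of_real (h_eta \<eta> * gap l)"

lemma h_pos: "h_eta \<eta> > 0"
  using Im_eta by (simp add: h_eta_def add_pos_nonneg)

lemma len_n_top: "filterlim (\<lambda>l. len \<xi> (n l)) at_top sequentially"
  by (rule filterlim_compose[OF len_filterlim n_top])

lemma ev_len_n: "\<forall>\<^sub>F l in sequentially. len \<xi> (n l) > 0"
  using len_n_top by (simp add: filterlim_at_top_dense)

lemma gap_top: "filterlim gap at_top sequentially"
proof -
  have "filterlim (\<lambda>l. (1 - len \<xi> (k l) / len \<xi> (n l)) * len \<xi> (n l)) at_top sequentially"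
    using sigma by (intro filterlim_tendsto_pos_mult_at_top[OF tendsto_diff[OF tendsto_const ratio] _ len_n_top]) simp
  then show ?thesis
    by (rule filterlim_mono_eventually)
       (use ev_len_n in \<open>auto elim!: eventually_mono simp: gap_def field_simps\<close>)
qed

lemma ev_gap: "\<forall>\<^sub>F l in sequentially. gap l > 0"
  using gap_top by (simp add: filterlim_at_top_dense)

lemma ratio_n: "(\<lambda>l. len \<xi> (n l) / gap l) \<longlonglongrightarrow> 1 / (1 - \<sigma>)"
proof (rule Lim_transform_eventually)
  show "(\<lambda>l. 1 / (1 - len \<xi> (k l) / len \<xi> (n l))) \<longlonglongrightarrow> 1 / (1 - \<sigma>)"
    using sigma by (intro tendsto_intros ratio) auto
  show "\<forall>\<^sub>F l in sequentially. 1 / (1 - len \<xi> (k l) / len \<xi> (n l)) = len \<xi> (n l) / gap l"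
    using ev_len_n ev_gap by eventually_elim (simp add: gap_def field_simps)
qed

lemma ratio_k: "(\<lambda>l. len \<xi> (k l) / gap l) \<longlonglongrightarrow> \<sigma> / (1 - \<sigma>)"
proof (rule Lim_transform_eventually)
  show "(\<lambda>l. (len \<xi> (k l) / len \<xi> (n l)) * (len \<xi> (n l) / gap l)) \<longlonglongrightarrow> \<sigma> / (1 - \<sigma>)"
    using tendsto_mult[OF ratio ratio_n] by simp
  show "\<forall>\<^sub>F l in sequentially. (len \<xi> (k l) / len \<xi> (n l)) * (len \<xi> (n l) / gap l) = len \<xi> (k l) / gap l"
    using ev_len_n by eventually_elim simp
qed

lemma resc_lim: "(\<lambda>l. resc l z) \<longlonglongrightarrow> 0"
proof -
  have "(\<lambda>l. z / of_real (h_eta \<eta>) * of_real (inverse (gap l))) \<longlonglongrightarrow> z / of_real (h_eta \<eta>) * of_real 0"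
    by (intro tendsto_intros tendsto_inverse_0_at_top gap_top)
  then show ?thesis by (simp add: resc_def field_simps)
qed

lemma n_bd: "bdd_below (range n)"
proof -
  have "\<forall>\<^sub>F l in sequentially. n l \<ge> 0" using n_top by (simp add: filterlim_at_top)
  then obtain L where L: "\<And>l. l \<ge> L \<Longrightarrow> n l \<ge> 0" by (auto simp: eventually_sequentially)
  have "Min (insert 0 (n ` {..<L})) \<le> n l" for l
  proof (cases "l < L")
    case False
    have "Min (insert 0 (n ` {..<L})) \<le> 0" by (rule Min_le) auto
    moreover have "0 \<le> n l" using L False by simp
    ultimately show ?thesis by (rule order_trans)
  qed (auto intro!: Min_le)
  then show ?thesis by (auto simp: bdd_below_def)
qed

lemma resc_len:
  assumes "(\<lambda>l. len \<xi> (c l) / gap l) \<longlonglongrightarrow> r"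
  shows "(\<lambda>l. resc l z * of_real (len \<xi> (c l))) \<longlonglongrightarrow> z / of_real (h_eta \<eta>) * of_real r"
proof -
  have "(\<lambda>l. z / of_real (h_eta \<eta>) * of_real (len \<xi> (c l) / gap l)) \<longlonglongrightarrow> z / of_real (h_eta \<eta>) * of_real r"
    by (intro tendsto_intros assms)
  then show ?thesis by (simp add: resc_def)
qed

text \<open>The rescaled times at the indices \<open>n l\<close> and \<open>k l\<close> tend to \<open>z / (1 - \<sigma>)\<close> and
  \<open>z \<sigma> / (1 - \<sigma>)\<close>; their difference is \<open>z\<close>.\<close>

lemma rel_transfer_lim:
  "(\<lambda>l. rel_transfer \<xi> (k l) (n l) (resc l z) $ i $ j) \<longlonglongrightarrow> rot \<eta> z $ i $ j"
proof -
  have h: "of_real (h_eta \<eta>) * (z / of_real (h_eta \<eta>) * of_real x) = z * of_real x" for x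
    using h_pos by simp
  have "(\<lambda>l. rel_fund \<xi> (n l) (resc l z) $ i $ j) \<longlonglongrightarrow> rot \<eta> (z / of_real (1 - \<sigma>)) $ i $ j" for i j
    using rel_fund_continuous_limit[OF n_bd resc_lim resc_len[OF ratio_n, of z], of i j]
    unfolding h by simp
  moreover have "(\<lambda>l. rel_fund \<xi> (k l) (resc l z) $ i $ j) \<longlonglongrightarrow> rot \<eta> (z * of_real \<sigma> / of_real (1 - \<sigma>)) $ i $ j" for i j
    using rel_fund_continuous_limit[OF k_bd resc_lim resc_len[OF ratio_k, of z], of i j]
    unfolding h by simp
  then have "(\<lambda>l. adj2 (rel_fund \<xi> (k l) (resc l z)) $ i $ j)
      \<longlonglongrightarrow> adj2 (rot \<eta> (z * of_real \<sigma> / of_real (1 - \<sigma>))) $ i $ j" for i j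
    using exhaust_2[of i] exhaust_2[of j] by (elim disjE) (simp_all add: tendsto_minus)
  ultimately have "(\<lambda>l. rel_transfer \<xi> (k l) (n l) (resc l z) $ i $ j)
     \<longlonglongrightarrow> (rot \<eta> (z / of_real (1 - \<sigma>)) ** adj2 (rot \<eta> (z * of_real \<sigma> / of_real (1 - \<sigma>)))) $ i $ j"
    unfolding rel_transfer_def mat_mult_nth2 by (intro tendsto_add tendsto_mult)
  also have "z / of_real (1 - \<sigma>) - z * of_real \<sigma> / of_real (1 - \<sigma>) = z"
  proof -
    have "of_real (1 - \<sigma>) \<noteq> (0 :: complex)" using sigma by (metis eq_iff_diff_eq_0 less_irrefl of_real_eq_0_iff)
    moreover have "z - z * of_real \<sigma> = z * of_real (1 - \<sigma>)" by (simp add: algebra_simps)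
    ultimately show ?thesis by (simp flip: diff_divide_distrib)
  qed
  then have "rot \<eta> (z / of_real (1 - \<sigma>)) ** adj2 (rot \<eta> (z * of_real \<sigma> / of_real (1 - \<sigma>))) = rot \<eta> z"
    by (simp only: rot_diff[OF Im_eta])
  finally show ?thesis .
qed

lemma rel_transfer_holomorphic:
  "(\<lambda>y. rel_transfer \<xi> (k l) (n l) (resc l y) $ i $ j) holomorphic_on UNIV" if "gap l > 0"
proof -
  have r: "(\<lambda>y. resc l y) holomorphic_on UNIV"
    unfolding resc_def using that h_pos by (intro holomorphic_intros) auto
  have "(\<lambda>y. adj2 (rel_fund \<xi> (k l) (resc l y)) $ i $ j) holomorphic_on UNIV" for i j
    using exhaust_2[of i] exhaust_2[of j]
    by (elim disjE) (simp_all add: rel_fund_holomorphic[OF r] holomorphic_on_minus)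
  then show ?thesis
    unfolding rel_transfer_def mat_mult_nth2
    by (intro holomorphic_intros rel_fund_holomorphic[OF r])
qed

lemma rel_transfer_bound:
  obtains c where "\<forall>\<^sub>F l in sequentially. \<forall>y i j. cmod (rel_transfer \<xi> (k l) (n l) (resc l y) $ i $ j) \<le> 2 * exp (c * cmod y)"
proof -
  obtain B where B: "\<And>l. \<bar>len \<xi> (n l) / gap l\<bar> \<le> B"
    using convergent_imp_Bseq[OF convergentI[OF ratio_n]] by (auto simp: Bseq_def)
  obtain C where C: "\<And>l. \<bar>len \<xi> (k l) / gap l\<bar> \<le> C"
    using convergent_imp_Bseq[OF convergentI[OF ratio_k]] by (auto simp: Bseq_def)
  have bd: "cmod (rel_fund \<xi> m (resc l y) $ i $ j) \<le> exp (2 * D / h_eta \<eta> * cmod y)"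
    if "\<bar>len \<xi> m / gap l\<bar> \<le> D" "gap l > 0" for m l y i j D
  proof -
    have "2 * cmod (resc l y) * \<bar>len \<xi> m\<bar> = 2 * cmod y / h_eta \<eta> * \<bar>len \<xi> m / gap l\<bar>"
      using that(2) h_pos by (simp add: resc_def norm_divide norm_mult)
    also have "\<dots> \<le> 2 * cmod y / h_eta \<eta> * D"
      using that(1) h_pos by (intro mult_left_mono) auto
    finally have "exp (2 * cmod (resc l y) * \<bar>len \<xi> m\<bar>) \<le> exp (2 * D / h_eta \<eta> * cmod y)"
      by (simp add: mult_ac)
    then show ?thesis
      using rel_fund_bound[of \<xi> m "resc l y" i j] by (rule order_trans[rotated])
  qed
  define c where "c = 2 * B / h_eta \<eta> + 2 * C / h_eta \<eta>"
  have "cmod (rel_transfer \<xi> (k l) (n l) (resc l y) $ i $ j) \<le> 2 * exp (c * cmod y)" if g: "gap l > 0" for l y i j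
  proof -
    have adj: "cmod (adj2 (rel_fund \<xi> (k l) (resc l y)) $ i $ j) \<le> exp (2 * C / h_eta \<eta> * cmod y)" for i j
      using exhaust_2[of i] exhaust_2[of j] bd[OF C g] by (elim disjE) auto
    have "cmod (rel_transfer \<xi> (k l) (n l) (resc l y) $ i $ j)
        \<le> exp (2 * B / h_eta \<eta> * cmod y) * exp (2 * C / h_eta \<eta> * cmod y)
          + exp (2 * B / h_eta \<eta> * cmod y) * exp (2 * C / h_eta \<eta> * cmod y)"
      unfolding rel_transfer_def mat_mult_nth2
      by (rule norm_triangle_mono; unfold norm_mult; intro mult_mono bd B g adj) auto
    then show ?thesis by (simp add: c_def distrib_right exp_add)
  qed
  then show ?thesis using ev_gap by (intro that[of c]) (auto elim: eventually_mono)
qed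

lemma rel_transfer_deriv_lim:
  "(\<lambda>l. deriv (\<lambda>y. rel_transfer \<xi> (k l) (n l) (resc l y) $ i $ j) z) \<longlonglongrightarrow> deriv (\<lambda>y. rot \<eta> y $ i $ j) z"
proof -
  obtain c where c: "\<forall>\<^sub>F l in sequentially. \<forall>y i j. cmod (rel_transfer \<xi> (k l) (n l) (resc l y) $ i $ j) \<le> 2 * exp (c * cmod y)"
    by (rule rel_transfer_bound)
  obtain L where L: "\<forall>l\<ge>L. gap l > 0 \<and> (\<forall>y i j. cmod (rel_transfer \<xi> (k l) (n l) (resc l y) $ i $ j) \<le> 2 * exp (c * cmod y))"
    using eventually_conj[OF ev_gap c] unfolding eventually_sequentially by blast
  define f where "f l y = rel_transfer \<xi> (k (l + L)) (n (l + L)) (resc (l + L) y) $ i $ j" for l y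
  have hol: "f l holomorphic_on UNIV" for l
    unfolding f_def using L by (intro rel_transfer_holomorphic) simp
  have "uniform_limit K f (\<lambda>y. rot \<eta> y $ i $ j) sequentially" if "compact K" for K
  proof (rule vitali_uniform[OF open_UNIV hol])
    show "\<exists>B. \<forall>l. \<forall>y\<in>K. cmod (f l y) \<le> B" if K: "compact K" for K
    proof -
      obtain B where B: "\<forall>y\<in>K. exp (c * cmod y) \<le> B" using compact_exp_bound[OF K, of c] by blast
      have "cmod (f l y) \<le> 2 * B" if "y \<in> K" for l y
      proof -
        have "cmod (f l y) \<le> 2 * exp (c * cmod y)" unfolding f_def using L by simp
        then show ?thesis using B that by force
      qed
      then show ?thesis by blast
    qed
    show "(\<lambda>l. f l y) \<longlonglongrightarrow> rot \<eta> y $ i $ j" for y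
      unfolding f_def using rel_transfer_lim by (rule LIMSEQ_ignore_initial_segment)
  qed (use that in auto)
  then have "(\<lambda>l. deriv (f l) z) \<longlonglongrightarrow> deriv (\<lambda>y. rot \<eta> y $ i $ j) z"
    by (rule deriv_tendsto_of_uniform_limit[OF hol])
  then show ?thesis unfolding f_def by (rule LIMSEQ_offset)
qed

end

section \<open>The universality limit\<close>

lemma DERIV_from_diagonal_quotient:
  fixes f g :: "complex \<Rightarrow> complex"
  assumes "\<And>y. f y = (c - y) * g y" "isCont g c"
  shows "(f has_field_derivative - g c) (at c)"
  unfolding CARAT_DERIV
proof (intro exI conjI allI)
  show "f y - f c = - g y * (y - c)" for y by (simp add: assms(1) algebra_simps)
  show "isCont (\<lambda>y. - g y) c" using assms(2) by (rule continuous_minus)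
qed simp

context kernel_scaling
begin

text \<open>With \<open>u\<close> the normalised vectors \<open>vvec\<close>, let \<open>N\<close> be the numerator \<open>jform\<close> of the kernel, rescaled, and \<open>Q\<close>
  the rescaled kernel itself, so that \<open>N = (cnj w - y) Q\<close>.  Off the diagonal one may divide.  On the
  diagonal \<open>Q\<close> is minus the derivative of \<open>N\<close>, and derivatives converge because the rescaled transfer
  matrices are locally uniformly bounded entire functions.\<close>

theorem rescaled_kernel_limit:
  assumes conv: "convergent (\<lambda>l. vvec a b \<xi> (k l) /\<^sub>R norm (vvec a b \<xi> (k l)))"
  shows "(\<lambda>l. kernel_fn a b (k l) (n l) (\<xi> + resc l z) (\<xi> + resc l w)
      / (of_real (gap l) * sesq_form (H_ring \<eta>) (vvec a b \<xi> (k l)) (vvec a b \<xi> (k l))))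
    \<longlonglongrightarrow> ext_quot (\<lambda>z' w'. sin (cnj w' - z')) z w"
proof -
  define v where "v l = vvec a b \<xi> (k l)" for l
  define u where "u l = inverse (norm (v l)) *\<^sub>R v l" for l
  define R where "R l y = rel_transfer \<xi> (k l) (n l) (resc l y)" for l y
  define h where "h = complex_of_real (h_eta \<eta>)"
  define X where "X l = R l w *v u l" for l
  define S where "S l = sesq_form (H_ring \<eta>) (u l) (u l)" for l
  define N where "N l y = h * jform (X l) (R l y *v u l) / S l" for l y
  define Q where "Q l y = kernel_fn a b (k l) (n l) (\<xi> + resc l y) (\<xi> + resc l w)
      / (of_real (gap l) * sesq_form (H_ring \<eta>) (v l) (v l))" for l y
  have h: "h \<noteq> 0" using h_pos by (simp add: h_def)
  have v0: "v l \<noteq> 0" for l by (simp add: v_def vvec_nonzero)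
  obtain x where x: "u \<longlonglongrightarrow> x"
    using conv unfolding convergent_def u_def v_def by blast
  have norm_u: "norm (u l) = 1" for l using v0[of l] by (simp add: u_def)
  have u_real: "cnj (u l $ i) = u l $ i" for l i
    unfolding u_def scaleR_nth2 by (simp add: v_def vvec_real)
  have norm_x: "norm x = 1"
    using LIMSEQ_unique[OF tendsto_norm[OF x]] by (simp add: norm_u)
  have xi: "(\<lambda>l. u l $ i) \<longlonglongrightarrow> x $ i" for i by (rule tendsto_vec_nth[OF x])
  have x_real: "cnj (x $ i) = x $ i" for i
    using LIMSEQ_unique[OF tendsto_cnj[OF xi[of i]]] xi[of i] by (simp add: u_real)
  have x0: "x \<noteq> 0" using norm_x by auto
  have u0: "u l \<noteq> 0" for l using norm_u[of l] by auto
  have S0: "S l \<noteq> 0" for l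
    unfolding S_def by (intro H_ring_form_nonzero u_real u0 Im_eta)
  define s where "s = sesq_form (H_ring \<eta>) x x"
  have s0: "s \<noteq> 0"
    unfolding s_def by (intro H_ring_form_nonzero x_real x0 Im_eta)
  have S_lim: "S \<longlonglongrightarrow> s"
    unfolding S_def s_def sesq_form_def sum_2 mat_vec_nth2 by (intro tendsto_intros xi)
  have R_lim: "(\<lambda>l. R l y $ i $ j) \<longlonglongrightarrow> rot \<eta> y $ i $ j" for y i j
    unfolding R_def by (rule rel_transfer_lim)
  have X_lim: "(\<lambda>l. X l $ i) \<longlonglongrightarrow> (rot \<eta> w *v x) $ i" for i
    unfolding X_def mat_vec_nth2 by (intro tendsto_add tendsto_mult R_lim xi)
  have N_lim: "(\<lambda>l. N l y) \<longlonglongrightarrow> h * jform (rot \<eta> w *v x) (rot \<eta> y *v x) / s" for y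
    unfolding N_def jform_def mat_vec_nth2[of "R _ y"] mat_vec_nth2[of "rot \<eta> y"]
    by (intro tendsto_divide tendsto_mult tendsto_diff tendsto_add tendsto_cnj tendsto_const X_lim R_lim xi S_lim s0)
  have N_sin: "h * jform (rot \<eta> w *v x) (rot \<eta> y *v x) / s = sin (cnj w - y)" for y
    using h s0 unfolding jform_rot[OF x_real x_real Im_eta] by (simp add: s_def h_def)
  have key: "N l y = (cnj w - y) * Q l y" if g: "gap l > 0" for l y
  proof -
    define r where "r = inverse (norm (v l))"
    have r: "of_real (r\<^sup>2) \<noteq> (0 :: complex)" using v0[of l] by (simp add: r_def)
    have hg: "h * of_real (gap l) \<noteq> 0" using h g by simp
    have arg: "cnj (\<xi> + resc l w) - (\<xi> + resc l y) = (cnj w - y) / (h * of_real (gap l))"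
      by (simp add: resc_def h_def diff_divide_distrib)
    have "jform (R l w *v v l) (R l y *v v l)
        = (cnj w - y) / (h * of_real (gap l)) * kernel_fn a b (k l) (n l) (\<xi> + resc l y) (\<xi> + resc l w)"
      unfolding R_def v_def kernel_fn_jform[symmetric] arg ..
    moreover have "N l y = h * jform (R l w *v v l) (R l y *v v l) / sesq_form (H_ring \<eta>) (v l) (v l)"
      unfolding N_def X_def S_def u_def r_def[symmetric] jform_scaleR sesq_form_scaleR using r by simp
    moreover define d where "d = cnj w - y"
    ultimately show ?thesis
      unfolding Q_def d_def[symmetric] using hg by (simp add: field_simps)
  qed
  have "(\<lambda>l. Q l z) \<longlonglongrightarrow> ext_quot (\<lambda>z' w'. sin (cnj w' - z')) z w"
  proof (cases "cnj w = z")
    case False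
    have "(\<lambda>l. N l z / (cnj w - z)) \<longlonglongrightarrow> sin (cnj w - z) / (cnj w - z)"
      using False N_lim[of z] unfolding N_sin by (intro tendsto_divide tendsto_const) auto
    moreover have "\<forall>\<^sub>F l in sequentially. N l z / (cnj w - z) = Q l z"
      using ev_gap by eventually_elim (use False in \<open>simp add: key\<close>)
    ultimately have "(\<lambda>l. Q l z) \<longlonglongrightarrow> sin (cnj w - z) / (cnj w - z)"
      by (rule Lim_transform_eventually)
    then show ?thesis using False by (simp add: ext_quot_def)
  next
    case True
    define D where "D A y = h * (cnj (y $ 2) * (A 1 1 * x $ 1 + A 1 2 * x $ 2)
        - cnj (y $ 1) * (A 2 1 * x $ 1 + A 2 2 * x $ 2)) / s" for A :: "2 \<Rightarrow> 2 \<Rightarrow> complex" and y :: "complex^2"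
    define dR where "dR l i j = deriv (\<lambda>y. R l y $ i $ j) z" for l i j
    define drot where "drot i j = deriv (\<lambda>y. rot \<eta> y $ i $ j) z" for i j
    define dN where "dN l = h * (cnj (X l $ 2) * (dR l 1 1 * u l $ 1 + dR l 1 2 * u l $ 2)
        - cnj (X l $ 1) * (dR l 2 1 * u l $ 1 + dR l 2 2 * u l $ 2)) / S l" for l
    have dR_lim: "(\<lambda>l. dR l i j) \<longlonglongrightarrow> drot i j" for i j
      unfolding dR_def drot_def R_def by (rule rel_transfer_deriv_lim)
    have dN_lim: "dN \<longlonglongrightarrow> D drot (rot \<eta> w *v x)"
      unfolding dN_def D_def
      by (intro tendsto_divide tendsto_mult tendsto_diff tendsto_add tendsto_cnj tendsto_const X_lim dR_lim xi S_lim s0)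
    have rot_der: "((\<lambda>y. rot \<eta> y $ i $ j) has_field_derivative drot i j) (at z)" for i j
    proof -
      have "(\<lambda>y. rot \<eta> y $ i $ j) holomorphic_on UNIV"
        using exhaust_2[of i] exhaust_2[of j] Im_eta
        by (elim disjE) (auto simp: rot_def intro!: holomorphic_intros)
      then show ?thesis unfolding drot_def by (rule holomorphic_derivI) auto
    qed
    have "((\<lambda>y. sin (cnj w - y)) has_field_derivative D drot (rot \<eta> w *v x)) (at z)"
      unfolding N_sin[symmetric] jform_def mat_vec_nth2[of "rot \<eta> y" for y] D_def
      by (rule derivative_eq_intros rot_der refl s0)+ (use s0 in \<open>simp add: field_simps\<close>)
    moreover have "((\<lambda>y. sin (cnj w - y)) has_field_derivative - 1) (at z)"
      by (rule derivative_eq_intros refl)+ (simp add: True)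
    ultimately have D1: "D drot (rot \<eta> w *v x) = - 1" by (rule DERIV_unique)
    have "dN l = - Q l z" if g: "gap l > 0" for l
    proof (rule DERIV_unique)
      have R_der: "((\<lambda>y. R l y $ i $ j) has_field_derivative dR l i j) (at z)" for i j
        unfolding dR_def R_def by (rule holomorphic_derivI[OF rel_transfer_holomorphic[OF g]]) auto
      show "(N l has_field_derivative dN l) (at z)"
        unfolding N_def[abs_def] jform_def mat_vec_nth2[of "R l y" for y] dN_def
        by (rule derivative_eq_intros R_der refl S0)+ (use S0[of l] in \<open>simp add: field_simps\<close>)
      have "continuous_on UNIV (Q l)"
        unfolding Q_def kernel_fn_eq resc_def using g h_pos S0[of l] v0[of l]
        by (intro continuous_intros continuous_cd_sum)
           (auto simp: H_ring_form_nonzero[OF _ _ _ Im_eta] v_def vvec_real vvec_nonzero)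
      then have "isCont (Q l) (cnj w)"
        by (simp add: continuous_on_eq_continuous_at)
      then show "(N l has_field_derivative - Q l z) (at z)"
        using DERIV_from_diagonal_quotient[of "N l" "cnj w" "Q l"] key[OF g] by (simp add: True)
    qed
    then have "\<forall>\<^sub>F l in sequentially. - dN l = Q l z"
      using ev_gap by (auto elim: eventually_mono)
    with tendsto_minus[OF dN_lim] have "(\<lambda>l. Q l z) \<longlonglongrightarrow> - D drot (rot \<eta> w *v x)"
      by (rule Lim_transform_eventually)
    then show ?thesis by (simp add: D1 ext_quot_sin_diagonal[OF True])
  qed
  then show ?thesis by (simp only: Q_def v_def)
qed

end

theorem lemma3p2:
  fixes a b :: "int \<Rightarrow> real" and \<xi> \<sigma> :: real and \<eta> z w :: complex and k n :: "nat \<Rightarrow> int"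
  assumes "\<And>m. a m > 0"
    and "limit_point_both a b"
    and "((\<lambda>y. m_plus a b (of_real \<xi> + \<i> * of_real y)) \<longlongrightarrow> \<eta>) (at_right (0::real))"
    and "Im \<eta> > 0"
    and "(\<lambda>l. tau a b \<xi> (k l) / tau a b \<xi> (n l)) \<longlonglongrightarrow> of_real \<sigma>"
    and "0 \<le> \<sigma>" and "\<sigma> < 1"
    and "bdd_below (range k)"
    and "filterlim n at_top sequentially"
    and "convergent (\<lambda>l. vvec a b \<xi> (k l) /\<^sub>R norm (vvec a b \<xi> (k l)))"
  shows "(\<lambda>l. kernel_fn a b (k l) (n l)
              (of_real \<xi> + z / (of_real (h_eta \<eta>) * (tau a b \<xi> (n l) - tau a b \<xi> (k l))))
              (of_real \<xi> + w / (of_real (h_eta \<eta>) * (tau a b \<xi> (n l) - tau a b \<xi> (k l))))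
            / ((tau a b \<xi> (n l) - tau a b \<xi> (k l))
                 * sesq_form (H_ring \<eta>) (vvec a b \<xi> (k l)) (vvec a b \<xi> (k l))))
         \<longlonglongrightarrow> ext_quot (\<lambda>z' w'. sin (cnj w' - z')) z w"
proof -
  interpret boundary_value_jacobi a b \<xi> \<eta>
    by standard (fact assms)+
  have "(\<lambda>l. complex_of_real (len \<xi> (k l) / len \<xi> (n l))) \<longlonglongrightarrow> of_real \<sigma>"
    using assms(5) by (simp add: tau_eq)
  then have ratio: "(\<lambda>l. len \<xi> (k l) / len \<xi> (n l)) \<longlonglongrightarrow> \<sigma>"
    by (simp only: tendsto_of_real_iff)
  interpret kernel_scaling a b \<xi> \<eta> k n \<sigma>
    by standard (fact ratio assms)+
  show ?thesis
    using rescaled_kernel_limit[OF assms(10), of z w]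
    by (simp add: tau_eq resc_def gap_def)
qed

end
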